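(* Let $n\geq 1$, $R=\mathbb{Z}[t^{\pm1}]$, $S=\mathbb{Z}[t^{\pm1}]/(t^2-1)$ and $\delta=1+t\in S$. Let $\mathbf{LB}_n$ act $S$-linearly on $S^{\oplus n-1}$ by the reduction modulo $t^2-1$ of the reduced Burau representation $\mathbf{LB}_n\to\mathrm{GL}_{n-1}(R)$. Then this $S$-linear action is a subrepresentation of an $S$-linear action of $\mathbf{LB}_n$ on $S^{\oplus n-1}\oplus S/(t-1)$, and the latter extends to an $S$-linear action of the extended loop braid group $\mathbf{LB}'_n$ on $S^{\oplus n-1}\oplus S/(t-1)$. Explicitly, let $x_1,\dots,x_{n-1}$ be the standard basis of $S^{\oplus n-1}$ and let $y$ be the generator of $S/(t-1)$ (so $ty=y$). There is a homomorphism $\mathbf{LB}'_n\to\mathrm{Aut}_S(S^{\oplus n-1}\oplus S/(t-1))$, whose restriction to $\mathbf{LB}_n$ and to the submodule $S^{\oplus n-1}\oplus 0$ is the reduction modulo $t^2-1$ of the reduced Burau representation, given on generators as follows (generators $x_j$, $y$ not mentioned are fixed). For $1\le i\le n-1$: - $\tau_i(x_{i-1})=x_{i-1}+x_i$ if $i\ge2$; $\tau_i(x_i)=-x_i$; $\tau_i(x_{i+1})=x_i+x_{i+1}$ if $i\le n-2$; and $\tau_{n-1}(y)=y-\delta x_{n-1}$. - $\sigma_i(x_{i-1})=x_{i-1}+t\,x_i$ if $i\ge2$; $\sigma_i(x_i)=-t\,x_i$; $\sigma_i(x_{i+1})=x_i+x_{i+1}$ if $i\le n-2$; and $\sigma_{n-1}(y)=y-\delta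 x_{n-1}$. - $\rho_i(x_{i-1})=x_{i-1}+\delta\sum_{j=i}^{n-1}x_j-y$ if $i\ge2$; $\rho_i(x_i)=-t\,x_i-\delta\sum_{j=i+1}^{n-1}x_j+y$. For $i=n$: - $\rho_n(x_{n-1})=x_{n-1}-y$ if $n\ge 2$; $\rho_n(y)=-y$.
   Context: Loop braid groups. Let $\mathbb{D}^3$ be the closed unit ball in $\mathbb{R}^3$ and $U_n$ a fixed oriented trivial $n$-component link in its interior. Let $\mathrm{Emb}^u(U_n,\mathbb{D}^3)$ be the path-component of the inclusion in the space of smooth embeddings of $U_n$ into the interior of $\mathbb{D}^3$ (smooth Whitney topology). Put $\mathcal{E}(U_n,\mathbb{D}^3)=\mathrm{Emb}^u(U_n,\mathbb{D}^3)/\mathrm{Diff}(U_n)$ and $\mathcal{E}^+(U_n,\mathbb{D}^3)=\mathrm{Emb}^u(U_n,\mathbb{D}^3)/\mathrm{Diff}^+(U_n)$, where $\mathrm{Diff}^+$ means orientation-preserving diffeomorphisms. The extended loop braid group is $\mathbf{LB}'_n=\pi_1(\mathcal{E}(U_n,\mathbb{D}^3))$ and the loop braid group is $\mathbf{LB}_n=\pi_1(\mathcal{E}^+(U_n,\mathbb{D}^3))$. The $2^n$-sheeted covering $\mathcal{E}^+\to\mathcal{E}$ makes $\mathbf{LB}_n$ a subgroup of index $2^n$ of $\mathbf{LB}'_n$. Take the basepoint to be $n$ circles in the $xy$-plane arranged in a row from left to right. $\mathbf{LB}_n$ is generated by $\tau_1,\dots,\tau_{n-1},\sigma_1,\dots,\sigma_{n-1}$,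 and $\mathbf{LB}'_n$ by these together with $\rho_1,\dots,\rho_n$. Both $\tau_i$ and $\sigma_i$ exchange the $i$-th and $(i+1)$-st circles; for $\tau_i$ no circle passes through the other, and for $\sigma_i$ the $i$-th circle passes through the $(i+1)$-st. The element $\rho_i$ flips the $i$-th circle by a half-rotation, reversing its orientation. $\mathbf{LB}'_n$ is also the group of isotopy classes of diffeomorphisms of $\mathbb{D}^3$, equal to the identity near $\partial\mathbb{D}^3$, preserving $U_n$ setwise. It thus acts on $\pi_1(\mathbb{D}^3\smallsetminus U_n)=F_n=\langle a_1,\dots,a_n\rangle$, where $a_j$ is a loop going once through the $j$-th circle. It is standard that this action is faithful, so $\mathbf{LB}'_n$ may be viewed as the subgroup of $\mathrm{Aut}(F_n)$ generated by $\tau_i:\ a_i\mapsto a_{i+1},\ a_{i+1}\mapsto a_i$; $\sigma_i:\ a_i\mapsto a_ia_{i+1}a_i^{-1},\ a_{i+1}\mapsto a_i$; and $\rho_i:\ a_i\mapsto a_i^{-1}$ (each fixing all other $a_j$), and $\mathbf{LB}_n$ as the subgroup generated by the $\tau_i$ and $\sigma_i$. Products are composed from right to left, as functions. Reduced Burau representation of $\mathbf{LB}_n$ over $R=\mathbb{Z}[t^{\pm1}]$. It is the homomorphism $\mathbf{LB}_n\to\mathrm{GL}_{n-1}(R)$ given on the standard basis $x_1,\dots,x_{n-1}$ of $R^{\oplus n-1}$ by: $\tau_i(x_{i-1})=x_{i-1}+x_i$, $\tau_i(x_i)=-x_i$, $\tau_i(x_{i+1})=x_i+x_{i+1}$; $\sigma_i(x_{i-1})=x_{i-1}+t\,x_i$,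 $\sigma_i(x_i)=-t\,x_i$, $\sigma_i(x_{i+1})=x_i+x_{i+1}$; all other $x_j$ are fixed, and formulas involving $x_0$ or $x_n$ are omitted. Reduction modulo $t^2-1$ means $-\otimes_R S$. *)

theory Defs
  imports
    "HOL-Algebra.Bij"
    "HOL-Algebra.Generated_Groups"
    "HOL-Library.Poly_Mapping"
    "Jordan_Normal_Form.VS_Connect"
begin

hide_const (open) Modules.module_hom

section \<open>Free groups\<close>

text \<open>A letter \<open>(x, True)\<close> stands for the generator \<open>x\<close>, and \<open>(x, False)\<close> for its inverse.\<close>

inductive cancel :: "('a \<times> bool) list \<Rightarrow> ('a \<times> bool) list \<Rightarrow> bool" where
  "cancel (u @ (x, b) # (x, \<not> b) # v) (u @ v)"

quotient_type 'a fgrp = "('a \<times> bool) list" / "equivclp cancel"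
  by (rule equivp_evquivclp)

lemma equivclp_cong:
  assumes "\<And>u v. R u v \<Longrightarrow> equivclp S (f u) (f v)" "equivclp R u v"
  shows "equivclp S (f u) (f v)"
  using assms(2)
proof (induction rule: equivclp_induct)
  case base
  show ?case by simp
next
  case (step y z)
  have "equivclp S (f y) (f z)"
    using step.hyps(2)
  proof
    assume "R y z"
    then show ?thesis by (rule assms(1))
  next
    assume "R z y"
    then show ?thesis by (intro equivclp_sym[OF assms(1)])
  qed
  with step.IH show ?case by (rule equivclp_trans)
qed

lemma cancel_append1: "cancel u v \<Longrightarrow> cancel (u @ w) (v @ w)"
proof (elim cancel.cases, clarify)
  fix p x b and q :: "('a \<times> bool) list"
  show "cancel ((p @ (x, b) # (x, \<not> b) # q) @ w) ((p @ q) @ w)"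
    using cancel.intros[of p x b "q @ w"] by simp
qed

lemma cancel_append2: "cancel u v \<Longrightarrow> cancel (w @ u) (w @ v)"
proof (elim cancel.cases, clarify)
  fix p x b and q :: "('a \<times> bool) list"
  show "cancel (w @ p @ (x, b) # (x, \<not> b) # q) (w @ p @ q)"
    using cancel.intros[of "w @ p" x b q] by simp
qed

abbreviation inv_word :: "('a \<times> bool) list \<Rightarrow> ('a \<times> bool) list" where
  "inv_word w \<equiv> rev (map (\<lambda>(x, b). (x, \<not> b)) w)"

lemma cancel_inv_word: "cancel u v \<Longrightarrow> cancel (inv_word u) (inv_word v)"
proof (elim cancel.cases, clarify)
  fix p x b and q :: "('a \<times> bool) list"
  show "cancel (inv_word (p @ (x, b) # (x, \<not> b) # q)) (inv_word (p @ q))"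
    using cancel.intros[of "inv_word q" x b "inv_word p"] by simp
qed

instantiation fgrp :: (type) "{monoid_mult, inverse}"
begin

lift_definition one_fgrp :: "'a fgrp" is "[]" .

lift_definition times_fgrp :: "'a fgrp \<Rightarrow> 'a fgrp \<Rightarrow> 'a fgrp" is "(@)"
proof -
  fix u u' v v' :: "('a \<times> bool) list"
  assume "equivclp cancel u u'" "equivclp cancel v v'"
  have "equivclp cancel (u @ v) (u' @ v)"
    by (rule equivclp_cong[where R = cancel, OF _ \<open>equivclp cancel u u'\<close>])
       (intro r_into_equivclp cancel_append1)
  moreover have "equivclp cancel (u' @ v) (u' @ v')"
    by (rule equivclp_cong[where R = cancel, OF _ \<open>equivclp cancel v v'\<close>])
       (intro r_into_equivclp cancel_append2)
  ultimately show "equivclp cancel (u @ v) (u' @ v')" by (rule equivclp_trans)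
qed

lift_definition inverse_fgrp :: "'a fgrp \<Rightarrow> 'a fgrp" is inv_word
proof -
  fix u v :: "('a \<times> bool) list"
  assume "equivclp cancel u v"
  then show "equivclp cancel (inv_word u) (inv_word v)"
    by (rule equivclp_cong[where R = cancel, rotated]) (intro r_into_equivclp cancel_inv_word)
qed

definition divide_fgrp :: "'a fgrp \<Rightarrow> 'a fgrp \<Rightarrow> 'a fgrp" where
  "divide_fgrp g h = g * inverse h"

instance
proof
  fix g h k :: "'a fgrp"
  show "g * h * k = g * (h * k)" by transfer simp
  show "1 * g = g" by transfer simp
  show "g * 1 = g" by transfer simp
qed

end

lemma fgrp_left_inverse: "inverse g * g = (1 :: 'a fgrp)"
proof transfer
  fix w :: "('a \<times> bool) list"
  show "equivclp cancel (inv_word w @ w) []"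
  proof (induction w)
    case (Cons a w)
    obtain x b where a: "a = (x, b)" by (cases a)
    have "cancel (inv_word (a # w) @ a # w) (inv_word w @ w)"
      using cancel.intros[of "inv_word w" x "\<not> b" w] by (simp add: a)
    then show ?case 
      by (rule equivclp_trans[OF r_into_equivclp Cons.IH])
  qed simp
qed

lift_definition gen :: "'a \<Rightarrow> 'a fgrp" is "\<lambda>x. [(x, True)]" .

text \<open>Words over \<open>A\<close> that are equivalent as words over the whole type are already equivalent as
  words over \<open>A\<close> (delete all letters outside \<open>A\<close>), so this is the free group with basis \<open>A\<close>.\<close>

definition free_group :: "'a set \<Rightarrow> 'a fgrp monoid" where
  "free_group A = \<lparr>carrier = {abs_fgrp w | w. fst ` set w \<subseteq> A}, mult = (*), one = 1\<rparr>"

lemma free_group_simps [simp]: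
  "mult (free_group A) = (*)" "one (free_group A) = 1"
  by (simp_all add: free_group_def)

lemma carrier_free_group: "carrier (free_group A) = {abs_fgrp w | w. fst ` set w \<subseteq> A}"
  by (simp add: free_group_def)

lemma free_group_closed:
  "1 \<in> carrier (free_group A)"
  "g \<in> carrier (free_group A) \<Longrightarrow> h \<in> carrier (free_group A) \<Longrightarrow> g * h \<in> carrier (free_group A)"
  "g \<in> carrier (free_group A) \<Longrightarrow> inverse g \<in> carrier (free_group A)"
  "x \<in> A \<Longrightarrow> gen x \<in> carrier (free_group A)"
proof -
  show "1 \<in> carrier (free_group A)"
    unfolding carrier_free_group one_fgrp.abs_eq by (auto intro!: exI[of _ "[]"])
  show "x \<in> A \<Longrightarrow> gen x \<in> carrier (free_group A)"
    unfolding carrier_free_group gen.abs_eq by (auto intro!: exI[of _ "[(x, True)]"])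
  show "g \<in> carrier (free_group A) \<Longrightarrow> h \<in> carrier (free_group A)
      \<Longrightarrow> g * h \<in> carrier (free_group A)"
    unfolding carrier_free_group
    by clarify (metis (no_types, lifting) image_Un le_sup_iff set_append times_fgrp.abs_eq)
  show "inverse g \<in> carrier (free_group A)" if "g \<in> carrier (free_group A)"
  proof -
    from that obtain w where w: "g = abs_fgrp w" "fst ` set w \<subseteq> A"
      unfolding carrier_free_group by blast
    have "fst ` set (inv_word w) = fst ` set w" by force
    then show ?thesis
      unfolding carrier_free_group w(1) inverse_fgrp.abs_eq using w(2) by blast
  qed
qed

lemma group_free_group: "group (free_group A)"
  by (rule groupI) (auto intro: free_group_closed fgrp_left_inverse simp: mult.assoc)


text \<open>The homomorphism with \<open>gen x \<mapsto> f x\<close>; the result does not depend on the chosen word.\<close>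

definition eval_word :: "('a \<Rightarrow> 'b fgrp) \<Rightarrow> ('a \<times> bool) list \<Rightarrow> 'b fgrp" where
  "eval_word f w = prod_list (map (\<lambda>(x, b). if b then f x else inverse (f x)) w)"

definition extend :: "('a \<Rightarrow> 'b fgrp) \<Rightarrow> 'a fgrp \<Rightarrow> 'b fgrp" where
  "extend f g = eval_word f (rep_fgrp g)"

lemma fgrp_right_inverse: "g * inverse g = (1 :: 'a fgrp)"
proof -
  interpret group "free_group (UNIV :: 'a set)" by (rule group_free_group)
  have "g \<in> carrier (free_group UNIV)"
    unfolding carrier_free_group by (induction g rule: fgrp.abs_induct) auto
  then show ?thesis
    using inv_equality[of "inverse g" g] r_inv[of g] free_group_closed(3)[of g UNIV]
      fgrp_left_inverse[of g] by simp
qed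

lemma eval_word_append: "eval_word f (u @ v) = eval_word f u * eval_word f v"
  by (simp add: eval_word_def)

lemma eval_word_cancel: "cancel u v \<Longrightarrow> eval_word f u = eval_word f v"
  by (auto elim!: cancel.cases simp: eval_word_def fgrp_left_inverse fgrp_right_inverse
      mult.assoc[symmetric]) (auto simp: mult.assoc fgrp_left_inverse fgrp_right_inverse)

lemma eval_word_equivclp: "equivclp cancel u v \<Longrightarrow> eval_word f u = eval_word f v"
  by (induction rule: equivclp_induct) (auto dest: eval_word_cancel[of _ _ f])

lemma extend_abs: "extend f (abs_fgrp w) = eval_word f w"
  unfolding extend_def
  by (rule eval_word_equivclp) (metis Quotient3_fgrp Quotient3_rep_abs equivp_def equivp_evquivclp)

lemma extend_gen [simp]: "extend f (gen x) = f x"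
  unfolding gen.abs_eq extend_abs by (simp add: eval_word_def)

lemma extend_mult [simp]: "extend f (g * h) = extend f g * extend f h"
  by (induction g rule: fgrp.abs_induct; induction h rule: fgrp.abs_induct)
     (simp add: times_fgrp.abs_eq extend_abs eval_word_append)

lemma extend_one [simp]: "extend f 1 = 1"
  using extend_abs[of f "[]"] by (simp add: one_fgrp.abs_eq[symmetric] eval_word_def)

lemma fgrp_inverse_unique: "g * h = 1 \<Longrightarrow> inverse g = (h :: 'a fgrp)"
  by (metis fgrp_left_inverse mult.assoc mult.left_neutral mult.right_neutral)

lemma extend_inverse [simp]: "extend f (inverse g) = inverse (extend f g)"
  by (metis extend_mult extend_one fgrp_inverse_unique fgrp_right_inverse)

lemma fgrp_inverse_inverse [simp]: "inverse (inverse g) = (g :: 'a fgrp)"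
  by (simp add: fgrp_inverse_unique fgrp_left_inverse)

lemma free_group_induct [consumes 1, case_names one gen inv]:
  assumes "g \<in> carrier (free_group A)"
    and "P 1"
    and "\<And>x h. x \<in> A \<Longrightarrow> P h \<Longrightarrow> P (gen x * h)"
    and "\<And>x h. x \<in> A \<Longrightarrow> P h \<Longrightarrow> P (inverse (gen x) * h)"
  shows "P g"
proof -
  from assms(1) obtain w where w: "g = abs_fgrp w" "fst ` set w \<subseteq> A"
    unfolding carrier_free_group by blast
  from w(2) have "P (abs_fgrp w)"
  proof (induction w)
    case Nil
    then show ?case using assms(2) by (simp add: one_fgrp.abs_eq)
  next
    case (Cons l w)
    obtain x b where l: "l = (x, b)" by (cases l)
    have "abs_fgrp (l # w) = (if b then gen x else inverse (gen x)) * abs_fgrp w"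
      by (simp add: l gen.abs_eq inverse_fgrp.abs_eq times_fgrp.abs_eq)
    with Cons show ?case using assms(3,4) by (auto simp: l)
  qed
  with w show ?thesis by simp
qed

lemma extend_closed:
  assumes "g \<in> carrier (free_group A)" "\<And>x. x \<in> A \<Longrightarrow> f x \<in> carrier (free_group B)"
  shows "extend f g \<in> carrier (free_group B)"
  using assms(1) by (induction rule: free_group_induct) (auto intro: free_group_closed assms(2))

lemma extend_extend_id:
  assumes "g \<in> carrier (free_group A)" "\<And>x. x \<in> A \<Longrightarrow> extend f' (f x) = gen x"
  shows "extend f' (extend f g) = g"
  using assms(1) by (induction rule: free_group_induct) (auto simp: assms(2))

lemma extend_in_auto:
  assumes "\<And>x. x \<in> A \<Longrightarrow> f x \<in> carrier (free_group A)"
    and "\<And>x. x \<in> A \<Longrightarrow> f' x \<in> carrier (free_group A)"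
    and "\<And>x. x \<in> A \<Longrightarrow> extend f' (f x) = gen x"
    and "\<And>x. x \<in> A \<Longrightarrow> extend f (f' x) = gen x"
  shows "restrict (extend f) (carrier (free_group A)) \<in> auto (free_group A)"
  unfolding auto_def Bij_def
  by (auto simp: hom_def extend_closed free_group_closed assms extend_extend_id
      intro!: bij_betw_byWitness[where f' = "extend f'"])


section \<open>Loop braid groups\<close>

text \<open>The mapping class group of the trivial link in the ball acts faithfully on the free group
  \<open>F\<^sub>n\<close>; we identify the (extended) loop braid group with its image in \<open>Aut(F\<^sub>n)\<close>. Multiplication in
  \<^const>\<open>AutoGroup\<close> is composition of functions, from right to left.\<close>

abbreviation F :: "nat \<Rightarrow> nat fgrp monoid" where
  "F n \<equiv> free_group {1..n}"

definition tau :: "nat \<Rightarrow> nat \<Rightarrow> nat fgrp \<Rightarrow> nat fgrp" where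
  "tau n i = restrict (extend (gen(i := gen (i + 1), i + 1 := gen i))) (carrier (F n))"

definition sigma :: "nat \<Rightarrow> nat \<Rightarrow> nat fgrp \<Rightarrow> nat fgrp" where
  "sigma n i = restrict
     (extend (gen(i := gen i * gen (i + 1) * inverse (gen i), i + 1 := gen i))) (carrier (F n))"

definition rho :: "nat \<Rightarrow> nat \<Rightarrow> nat fgrp \<Rightarrow> nat fgrp" where
  "rho n i = restrict (extend (gen(i := inverse (gen i)))) (carrier (F n))"

definition LB :: "nat \<Rightarrow> (nat fgrp \<Rightarrow> nat fgrp) monoid" where
  "LB n = subgroup_generated (AutoGroup (F n)) (tau n ` {1..n - 1} \<union> sigma n ` {1..n - 1})"

definition LB_ext :: "nat \<Rightarrow> (nat fgrp \<Rightarrow> nat fgrp) monoid" where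
  "LB_ext n = subgroup_generated (AutoGroup (F n))
     (tau n ` {1..n - 1} \<union> sigma n ` {1..n - 1} \<union> rho n ` {1..n})"

lemma carrier_AutoGroup: "carrier (AutoGroup G) = auto G"
  by (simp add: AutoGroup_def)

lemma generators_in_Aut:
  shows "i \<in> {1..n - 1} \<Longrightarrow> tau n i \<in> carrier (AutoGroup (F n))"
    and "i \<in> {1..n - 1} \<Longrightarrow> sigma n i \<in> carrier (AutoGroup (F n))"
    and "i \<in> {1..n} \<Longrightarrow> rho n i \<in> carrier (AutoGroup (F n))"
proof -
  assume i: "i \<in> {1..n - 1}"
  show "tau n i \<in> carrier (AutoGroup (F n))"
    unfolding tau_def carrier_AutoGroup
    by (rule extend_in_auto[where f' = "gen(i := gen (i + 1), i + 1 := gen i)"])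
       (use i in \<open>auto intro: free_group_closed\<close>)
  show "sigma n i \<in> carrier (AutoGroup (F n))"
    unfolding sigma_def carrier_AutoGroup
    by (rule extend_in_auto[where
          f' = "gen(i := gen (i + 1), i + 1 := inverse (gen (i + 1)) * gen i * gen (i + 1))"])
       (use i in \<open>auto intro!: free_group_closed
          simp: mult.assoc fgrp_left_inverse fgrp_right_inverse\<close>,
        (simp add: mult.assoc[symmetric] fgrp_left_inverse fgrp_right_inverse)+)
next
  assume i: "i \<in> {1..n}"
  show "rho n i \<in> carrier (AutoGroup (F n))"
    unfolding rho_def carrier_AutoGroup
    by (rule extend_in_auto[where f' = "gen(i := inverse (gen i))"])
       (use i in \<open>auto intro!: free_group_closed\<close>)
qed

lemma group_LB: "group (LB n)" and group_LB_ext: "group (LB_ext n)"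
  by (simp_all add: LB_def LB_ext_def group.group_subgroup_generated
      group.AutoGroup group_free_group)

lemma LB_subset_LB_ext: "carrier (LB n) \<subseteq> carrier (LB_ext n)"
  unfolding LB_def LB_ext_def carrier_subgroup_generated
  by (intro group.mono_generate group.AutoGroup group_free_group) auto


section \<open>Coefficient rings\<close>

text \<open>Finitely supported maps from \<^typ>\<open>int\<close> to \<^typ>\<open>int\<close> with the convolution product are the
  group ring of the integers, i.e. the Laurent polynomials with integer coefficients.\<close>

type_synonym laurent = "int \<Rightarrow>\<^sub>0 int"

definition t_R :: laurent where
  "t_R = Poly_Mapping.single 1 1"

lemma t_R_invertible: "t_R * Poly_Mapping.single (- 1) 1 = 1"
  by (simp add: t_R_def mult_single)

lemma equivp_dvd: "equivp (\<lambda>a b :: 'a :: comm_ring_1. m dvd a - b)"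
  by (intro equivpI reflpI sympI transpI)
     (simp, metis dvd_minus_iff minus_diff_eq, metis diff_add_cancel add_diff_eq dvd_add)

lemma dvd_minus_cong:
  fixes m :: "'a :: comm_ring_1"
  assumes "m dvd a - b" "m dvd c - d"
  shows "m dvd (a - c) - (b - d)"
proof -
  have "(a - c) - (b - d) = (a - b) - (c - d)" by simp
  then show ?thesis using assms by (simp only: dvd_diff)
qed

quotient_type laurent2 = laurent / "\<lambda>a b. t_R\<^sup>2 - 1 dvd a - b"
  by (rule equivp_dvd)

definition augment :: "laurent \<Rightarrow> int" where
  "augment f = (\<Sum>k\<in>Poly_Mapping.keys f. Poly_Mapping.lookup f k)"

lemma augment_superset:
  "finite K \<Longrightarrow> Poly_Mapping.keys f \<subseteq> K \<Longrightarrow> augment f = (\<Sum>k\<in>K. Poly_Mapping.lookup f k)"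
  unfolding augment_def by (rule sum.mono_neutral_left) (auto simp: in_keys_iff)

lemma augment_diff: "augment (f - g) = augment f - augment g"
proof -
  let ?K = "Poly_Mapping.keys f \<union> Poly_Mapping.keys g"
  have "augment h = (\<Sum>k\<in>?K. Poly_Mapping.lookup h k)" if "h \<in> {f, g, f - g}" for h
    by (rule augment_superset) (use that in \<open>auto simp: in_keys_iff lookup_minus\<close>)
  then show ?thesis by (simp add: lookup_minus sum_subtractf)
qed

lemma lookup_t_mult: "Poly_Mapping.lookup (t_R * f) k = Poly_Mapping.lookup f (k - 1)"
proof -
  have "Poly_Mapping.lookup (t_R * f) k
      = Sum_any (\<lambda>l. Sum_any (\<lambda>q. Poly_Mapping.lookup f q when k = l + q) when l = 1)"
    unfolding t_R_def lookup_mult by (rule Sum_any.cong) (simp add: lookup_single when_def)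
  also have "\<dots> = Sum_any (\<lambda>q. Poly_Mapping.lookup f q when k = 1 + q)"
    by (rule Sum_any_when_equal)
  also have "\<dots> = Sum_any (\<lambda>q. Poly_Mapping.lookup f q when q = k - 1)"
    by (rule Sum_any.cong) (auto simp: when_def)
  also have "\<dots> = Poly_Mapping.lookup f (k - 1)"
    by (rule Sum_any_when_equal)
  finally show ?thesis .
qed

lemma augment_t_mult: "augment (t_R * f) = augment f"
proof -
  have "Poly_Mapping.keys (t_R * f) = (\<lambda>k. k + 1) ` Poly_Mapping.keys f"
    by (force simp: in_keys_iff lookup_t_mult image_iff)
  then show ?thesis
    unfolding augment_def by (simp add: sum.reindex inj_on_def lookup_t_mult)
qed

instantiation laurent2 :: comm_ring_1
begin

lift_definition zero_laurent2 :: laurent2 is 0 .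
lift_definition one_laurent2 :: laurent2 is 1 .
lift_definition plus_laurent2 :: "laurent2 \<Rightarrow> laurent2 \<Rightarrow> laurent2" is "(+)"
  by (metis add_diff_add dvd_add)
lift_definition uminus_laurent2 :: "laurent2 \<Rightarrow> laurent2" is uminus
  by (metis dvd_minus_iff minus_diff_minus)
lift_definition minus_laurent2 :: "laurent2 \<Rightarrow> laurent2 \<Rightarrow> laurent2" is "(-)"
  by (rule dvd_minus_cong)
lift_definition times_laurent2 :: "laurent2 \<Rightarrow> laurent2 \<Rightarrow> laurent2" is "(*)"
  by (metis dvd_add dvd_mult dvd_mult2 mult_diff_mult)

instance
proof
  show "(0 :: laurent2) \<noteq> 1"
  proof transfer
    show "\<not> t_R\<^sup>2 - 1 dvd 0 - 1"
    proof
      assume "t_R\<^sup>2 - 1 dvd 0 - 1"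
      then obtain f where "0 - 1 = (t_R\<^sup>2 - 1) * f" by (elim dvdE)
      also have "\<dots> = t_R * (t_R * f) - f" by (simp add: power2_eq_square algebra_simps)
      finally have "augment (0 - 1) = 0" by (simp only: augment_diff augment_t_mult diff_self)
      then show False by (simp add: augment_diff) (simp add: augment_def)
    qed
  qed
qed (transfer; simp add: algebra_simps)+

end

definition mod2 :: "laurent \<Rightarrow> laurent2" where
  "mod2 = abs_laurent2"

lemma mod2_hom: "comm_ring_hom mod2"
  by standard (simp_all add: mod2_def zero_laurent2.abs_eq one_laurent2.abs_eq
      plus_laurent2.abs_eq times_laurent2.abs_eq)

definition t_S :: laurent2 where "t_S = mod2 t_R"

definition delta :: laurent2 where "delta = 1 + t_S"

lemma t_S_square: "t_S * t_S = 1"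
  by (simp add: t_S_def mod2_def one_laurent2.abs_eq times_laurent2.abs_eq
      laurent2.abs_eq_iff power2_eq_square)

text \<open>The cyclic \<open>S\<close>-module \<open>S/(t - 1)\<close>, with generator \<open>cyc_gen\<close>.\<close>

lifting_forget laurent2.lifting

quotient_type cyc = laurent2 / "\<lambda>a b. t_S - 1 dvd a - b"
  by (rule equivp_dvd)

instantiation cyc :: ab_group_add
begin

lift_definition zero_cyc :: cyc is 0 .
lift_definition plus_cyc :: "cyc \<Rightarrow> cyc \<Rightarrow> cyc" is "(+)"
  by (metis add_diff_add dvd_add)
lift_definition uminus_cyc :: "cyc \<Rightarrow> cyc" is uminus
  by (metis dvd_minus_iff minus_diff_minus)
lift_definition minus_cyc :: "cyc \<Rightarrow> cyc \<Rightarrow> cyc" is "(-)"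
  by (rule dvd_minus_cong)

instance
  by standard (transfer; simp add: algebra_simps)+

end

lift_definition cyc_gen :: cyc is 1 .

lift_definition cyc_smult :: "laurent2 \<Rightarrow> cyc \<Rightarrow> cyc" is "(*)"
  by (metis dvd_mult right_diff_distrib)

definition cyc_module :: "(laurent2, cyc) module" where
  "cyc_module = \<lparr>carrier = UNIV, mult = undefined, one = undefined,
     zero = 0, add = (+), smult = cyc_smult\<rparr>"

lemma t_cyc_gen: "t_S \<odot>\<^bsub>cyc_module\<^esub> cyc_gen = cyc_gen"
  unfolding cyc_module_def by simp (transfer, simp)


section \<open>Linear actions\<close>

text \<open>Automorphism group of a module, in analogy to \<^const>\<open>AutoGroup\<close>. A linear action of a
  group \<open>G\<close> on an \<open>R\<close>-module \<open>M\<close> is an element of \<open>hom G (mod_Aut R M)\<close>.\<close>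

definition mod_Aut :: "('a, 'c) ring_scheme \<Rightarrow> ('a, 'b, 'd) module_scheme \<Rightarrow> ('b \<Rightarrow> 'b) monoid" where
  "mod_Aut R M = BijGroup (carrier M) \<lparr>carrier := module_hom R M M \<inter> Bij (carrier M)\<rparr>"

definition GL :: "'a :: comm_ring_1 itself \<Rightarrow> nat \<Rightarrow> 'a mat monoid" where
  "GL ty k = units_of (ring_mat ty k ())"

text \<open>\<open>S\<^sup>n\<^sup>-\<^sup>1 \<oplus> S/(t - 1)\<close>\<close>

definition ext_module :: "nat \<Rightarrow> (laurent2, laurent2 vec \<times> cyc) module" where
  "ext_module n = direct_sum (module_vec TYPE(laurent2) (n - 1)) cyc_module"

text \<open>The standard basis is indexed from 1, whereas \<^const>\<open>unit_vec\<close> counts from 0.\<close>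

definition basis :: "nat \<Rightarrow> nat \<Rightarrow> 'a :: comm_ring_1 vec" where
  "basis n j = unit_vec (n - 1) (j - 1)"

definition x_gen :: "nat \<Rightarrow> nat \<Rightarrow> laurent2 vec \<times> cyc" where
  "x_gen n j = (basis n j, 0)"

definition y_gen :: "nat \<Rightarrow> laurent2 vec \<times> cyc" where
  "y_gen n = (0\<^sub>v (n - 1), cyc_gen)"

text \<open>The conditions on the generators determine \<open>\<beta>\<close> on \<open>LB n\<close>, see \<open>reduced_burau_unique\<close> below.
  Reduction modulo \<open>t\<^sup>2 - 1\<close> of the representation is \<open>g \<mapsto> map_mat mod2 (\<beta> g)\<close>.\<close>

definition reduced_burau :: "nat \<Rightarrow> ((nat fgrp \<Rightarrow> nat fgrp) \<Rightarrow> laurent mat) \<Rightarrow> bool" where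
  "reduced_burau n \<beta> \<longleftrightarrow>
     \<beta> \<in> hom (LB n) (GL TYPE(laurent) (n - 1)) \<and>
     (\<forall>i\<in>{1..n - 1}.
        (i \<ge> 2 \<longrightarrow> \<beta> (tau n i) *\<^sub>v basis n (i - 1) = basis n (i - 1) + basis n i) \<and>
        \<beta> (tau n i) *\<^sub>v basis n i = - basis n i \<and>
        (i \<le> n - 2 \<longrightarrow> \<beta> (tau n i) *\<^sub>v basis n (i + 1) = basis n i + basis n (i + 1)) \<and>
        (\<forall>j\<in>{1..n - 1} - {i - 1, i, i + 1}. \<beta> (tau n i) *\<^sub>v basis n j = basis n j)) \<and>
     (\<forall>i\<in>{1..n - 1}.
        (i \<ge> 2 \<longrightarrow> \<beta> (sigma n i) *\<^sub>v basis n (i - 1) = basis n (i - 1) + t_R \<cdot>\<^sub>v basis n i) \<and>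
        \<beta> (sigma n i) *\<^sub>v basis n i = - (t_R \<cdot>\<^sub>v basis n i) \<and>
        (i \<le> n - 2 \<longrightarrow> \<beta> (sigma n i) *\<^sub>v basis n (i + 1) = basis n i + basis n (i + 1)) \<and>
        (\<forall>j\<in>{1..n - 1} - {i - 1, i, i + 1}. \<beta> (sigma n i) *\<^sub>v basis n j = basis n j))"

lemma module_cyc: "module class_ring cyc_module"
proof (rule moduleI)
  show "abelian_group cyc_module"
  proof (rule abelian_groupI)
    fix a assume "a \<in> carrier cyc_module"
    show "\<exists>b\<in>carrier cyc_module. b \<oplus>\<^bsub>cyc_module\<^esub> a = \<zero>\<^bsub>cyc_module\<^esub>"
      by (rule bexI[of _ "- a"]) (simp_all add: cyc_module_def)
  qed (auto simp: cyc_module_def add.assoc add.commute)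
qed (simp_all add: cyc_module_def class_cring.is_cring; transfer; simp add: algebra_simps)+

lemma module_module_vec: "module class_ring (module_vec TYPE('a :: comm_ring_1) k)"
proof (rule moduleI)
  show "abelian_group (module_vec TYPE('a) k)"
  proof (rule abelian_groupI)
    fix v assume "v \<in> carrier (module_vec TYPE('a) k)"
    then show "\<exists>w\<in>carrier (module_vec TYPE('a) k).
        w \<oplus>\<^bsub>module_vec TYPE('a) k\<^esub> v = \<zero>\<^bsub>module_vec TYPE('a) k\<^esub>"
      by (intro bexI[of _ "- v"]) (simp_all add: module_vec_simps uminus_l_inv_vec)
  qed (auto simp: module_vec_simps comm_add_vec[of _ k])
qed (auto simp: module_vec_def class_cring.is_cring add_smult_distrib_vec smult_add_distrib_vec
    smult_smult_assoc)

lemma module_ext_module: "module class_ring (ext_module n)"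
  unfolding ext_module_def by (intro direct_sum_is_module module_cyc module_module_vec)

lemma group_mod_Aut:
  assumes "module R M"
  shows "group (mod_Aut R M)"
proof -
  interpret Module.module R M by (rule assms)
  let ?C = "carrier M"
  have "subgroup (module_hom R M M \<inter> Bij ?C) (BijGroup ?C)"
  proof (rule group.subgroupI[OF group_BijGroup])
    show "module_hom R M M \<inter> Bij ?C \<subseteq> carrier (BijGroup ?C)"
      by (simp add: BijGroup_def)
    have "(\<lambda>x\<in>?C. x) \<in> module_hom R M M \<inter> Bij ?C"
      by (auto simp: LinearCombinations.module_hom_def id_Bij)
    then show "module_hom R M M \<inter> Bij ?C \<noteq> {}" by blast
  next
    fix f
    assume f: "f \<in> module_hom R M M \<inter> Bij ?C"
    let ?g = "inv_into ?C f"
    have bij: "bij_betw f ?C ?C" using f by (simp add: Bij_def)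
    have g: "?g x \<in> ?C" "f (?g x) = x" "?g (f x) = x" if "x \<in> ?C" for x
      using bij that by (auto simp: bij_betw_inv_into_right bij_betw_inv_into_left
          dest: bij_betw_inv_into bij_betwE)
    have "?g (x \<oplus>\<^bsub>M\<^esub> y) = ?g x \<oplus>\<^bsub>M\<^esub> ?g y" if "x \<in> ?C" "y \<in> ?C" for x y
    proof -
      have "f (?g x \<oplus>\<^bsub>M\<^esub> ?g y) = x \<oplus>\<^bsub>M\<^esub> y"
        using f that g by (auto simp: LinearCombinations.module_hom_add)
      then show ?thesis using g that by (metis M.a_closed)
    qed
    moreover have "?g (r \<odot>\<^bsub>M\<^esub> x) = r \<odot>\<^bsub>M\<^esub> ?g x" if "r \<in> carrier R" "x \<in> ?C" for r x
    proof -
      have "f (r \<odot>\<^bsub>M\<^esub> ?g x) = r \<odot>\<^bsub>M\<^esub> x"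
        using f that g by (auto simp: LinearCombinations.module_hom_smult)
      then show ?thesis using g that by (metis smult_closed)
    qed
    ultimately show "inv\<^bsub>BijGroup ?C\<^esub> f \<in> module_hom R M M \<inter> Bij ?C"
      using f g restrict_inv_into_Bij[of f ?C] by (auto simp: inv_BijGroup LinearCombinations.module_hom_def)
  next
    fix f g
    assume "f \<in> module_hom R M M \<inter> Bij ?C" "g \<in> module_hom R M M \<inter> Bij ?C"
    then show "f \<otimes>\<^bsub>BijGroup ?C\<^esub> g \<in> module_hom R M M \<inter> Bij ?C"
      by (auto simp: BijGroup_def compose_Bij) (auto simp: LinearCombinations.module_hom_def compose_def Pi_iff)
  qed
  then show ?thesis
    unfolding mod_Aut_def by (rule subgroup.subgroup_is_group[OF _ group_BijGroup])
qed

lemma group_GL: "group (GL TYPE('a :: comm_ring_1) k)"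
  unfolding GL_def by (intro monoid.units_group ring.is_monoid ring_mat)

lemma basis_eqI:
  assumes "A \<in> carrier_mat (n - 1) (n - 1)" "B \<in> carrier_mat (n - 1) (n - 1)"
    and "\<And>j. j \<in> {1..n - 1} \<Longrightarrow> A *\<^sub>v basis n j = B *\<^sub>v (basis n j :: 'a :: comm_ring_1 vec)"
  shows "A = B"
proof (rule eq_matI)
  fix i j assume ij: "i < dim_row B" "j < dim_col B"
  then have "(A *\<^sub>v basis n (Suc j)) $ i = (B *\<^sub>v (basis n (Suc j))) $ i"
    using assms by auto
  then show "A $$ (i, j) = B $$ (i, j)"
    using assms(1,2) ij by (simp add: basis_def)
qed (use assms in auto)

lemma reduced_burau_unique:
  assumes "reduced_burau n \<beta>" "reduced_burau n \<beta>'" "g \<in> carrier (LB n)"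
  shows "\<beta> g = \<beta>' g"
proof -
  let ?X = "tau n ` {1..n - 1} \<union> sigma n ` {1..n - 1}"
  let ?A = "AutoGroup (F n)" and ?G = "GL TYPE(laurent) (n - 1)"
  interpret A: group ?A by (rule group.AutoGroup[OF group_free_group])
  have X: "?X \<subseteq> carrier ?A" using generators_in_Aut by blast
  have LB: "carrier (LB n) = generate ?A ?X"
    unfolding LB_def carrier_subgroup_generated using X by (simp add: Int_absorb1)
  have hom: "\<beta> \<in> hom (LB n) ?G" "\<beta>' \<in> hom (LB n) ?G"
    using assms(1,2) by (simp_all add: reduced_burau_def)
  interpret b: group_hom "LB n" ?G \<beta>
    by (intro group_hom.intro group_hom_axioms.intro group_LB group_GL hom)
  interpret b': group_hom "LB n" ?G \<beta>'
    by (intro group_hom.intro group_hom_axioms.intro group_LB group_GL hom)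
  have mat: "\<beta> h \<in> carrier_mat (n - 1) (n - 1)" "\<beta>' h \<in> carrier_mat (n - 1) (n - 1)"
    if "h \<in> carrier (LB n)" for h
    using b.hom_closed[OF that] b'.hom_closed[OF that]
    by (simp_all add: GL_def units_of_carrier Units_def ring_mat_simps)
  have gens: "\<beta> h = \<beta>' h" if h: "h \<in> ?X" for h
  proof (rule basis_eqI[of _ n])
    have hLB: "h \<in> carrier (LB n)" unfolding LB using h by (rule generate.incl)
    show "\<beta> h \<in> carrier_mat (n - 1) (n - 1)" "\<beta>' h \<in> carrier_mat (n - 1) (n - 1)"
      using mat[OF hLB] by simp_all
    fix j assume j: "j \<in> {1..n - 1}"
    from h obtain i where i: "i \<in> {1..n - 1}" "h = tau n i \<or> h = sigma n i" by blast
    consider "i \<ge> 2" "j = i - 1" | "j = i" | "i \<le> n - 2" "j = i + 1"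
      | "j \<in> {1..n - 1} - {i - 1, i, i + 1}"
      using i(1) j by force
    then show "\<beta> h *\<^sub>v basis n j = \<beta>' h *\<^sub>v basis n j"
      using assms(1,2) i unfolding reduced_burau_def by cases (elim disjE; simp)+
  qed
  have "g \<in> generate ?A ?X" using assms(3) LB by simp
  then show ?thesis
  proof (induction rule: generate.induct)
    case one
    then show ?case using b.hom_one b'.hom_one by (simp add: LB_def)
  next
    case (incl h)
    then show ?case by (rule gens)
  next
    case (inv h)
    have h: "h \<in> carrier (LB n)" unfolding LB using inv by (rule generate.incl)
    have "inv\<^bsub>?A\<^esub> h = inv\<^bsub>LB n\<^esub> h"
      using h unfolding LB_def by (rule A.inv_subgroup_generated[symmetric])
    then show ?case using gens[OF inv] b.hom_inv[OF h] b'.hom_inv[OF h] by simp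
  next
    case (eng h1 h2)
    then have h: "h1 \<in> carrier (LB n)" "h2 \<in> carrier (LB n)" by (simp_all add: LB)
    have "h1 \<otimes>\<^bsub>?A\<^esub> h2 = h1 \<otimes>\<^bsub>LB n\<^esub> h2" by (simp add: LB_def)
    then show ?case using eng.IH b.hom_mult[OF h] b'.hom_mult[OF h] by simp
  qed
qed

end

theory Submission
  imports Defs
begin

text \<open>
  Write \<open>e\<^sub>1, \<dots>, e\<^sub>n\<close> for the unit vectors, let \<open>D w\<close> be the vector of Fox derivatives of a word \<open>w\<close>
  in \<open>a\<^sub>1, \<dots>, a\<^sub>n\<close>, with every generator evaluated at \<open>t\<close>, and let \<open>eps\<close> be the homomorphism with
  \<open>a\<^sub>j \<mapsto> t\<close>. If an automorphism \<open>g\<close> of the free group respects \<open>eps\<close>, then the linear map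
  \<open>e\<^sub>j \<mapsto> D (g a\<^sub>j)\<close> sends \<open>D w\<close> to \<open>D (g w)\<close> (\<open>act_fox\<close>). Hence \<open>g\<close> acts in a functorial manner
  (\<open>act_mult\<close>), and homomorphisms out of the loop braid groups are obtained without a presentation.

  Over \<open>R\<close> the automorphisms \<open>\<tau>\<^sub>i\<close> and \<open>\<sigma>\<^sub>i\<close> respect \<open>eps\<close> and preserve the vectors of entry sum zero,
  a free module with basis \<open>x\<^sub>j = e\<^sub>j - e\<^sub>j\<^sub>+\<^sub>1\<close>. In this basis the action is the reduced Burau
  representation (\<open>reduced_burau_fox\<close>).

  The flip \<open>\<rho>\<^sub>i\<close> sends \<open>a\<^sub>i\<close>, of value \<open>t\<close>, to \<open>a\<^sub>i\<^sup>-\<^sup>1\<close>, of value \<open>t\<^sup>-\<^sup>1\<close>. It respects \<open>eps\<close> as soon as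
  \<open>t\<^sup>2 = 1\<close>, so over \<open>S\<close> the whole extended group acts on \<open>S\<^sup>n\<close>. The flip acts by \<open>e\<^sub>i \<mapsto> - t e\<^sub>i\<close> and no
  longer preserves entry sums; but \<open>- t = 1 - \<delta>\<close>, so it preserves them modulo \<open>\<delta>\<close>
  (\<open>LB_ext_eps_auts\<close>). The extended group therefore acts on the vectors whose entry sum lies in
  \<open>\<delta> S\<close>. These form the direct sum of the vectors of entry sum zero and of the multiples of \<open>\<delta> e\<^sub>n\<close>,
  and the latter are a copy of \<open>S/(t - 1)\<close>, because \<open>t - 1\<close> generates the annihilator of \<open>\<delta>\<close>
  (\<open>delta_annihilator\<close>). With \<open>y = - \<delta> e\<^sub>n\<close> this is the module of the theorem (\<open>emb_inj\<close>,
  \<open>emb_surj\<close>), and the action is the one in question (\<open>ext_action_hom\<close>); the formulas on generators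
  are read off from Fox derivatives.
\<close>

(* The index set {1..n} of the generators would otherwise be rewritten to {Suc 0..n}. *)
declare One_nat_def [simp del]

section \<open>Automorphisms of free groups\<close>

lemma gen_closed: "j \<in> {1..n} \<Longrightarrow> gen j \<in> carrier (F n)"
  by (rule free_group_closed)

lemma auto_mult:
  "g \<in> auto (F n) \<Longrightarrow> v \<in> carrier (F n) \<Longrightarrow> w \<in> carrier (F n) \<Longrightarrow> g (v * w) = g v * g w"
  by (simp add: auto_def hom_def)

lemma auto_closed: "g \<in> auto (F n) \<Longrightarrow> w \<in> carrier (F n) \<Longrightarrow> g w \<in> carrier (F n)"
  by (auto simp: auto_def hom_def)

lemma auto_one:
  assumes "g \<in> auto (F n)"
  shows "g 1 = 1"
proof -
  have "g 1 * g 1 = g 1"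
    using auto_mult[OF assms, of 1 1] by (simp add: free_group_closed)
  then have "inverse (g 1) * (g 1 * g 1) = inverse (g 1) * g 1" by simp
  then show ?thesis by (simp add: mult.assoc[symmetric] fgrp_left_inverse)
qed

lemma auto_inverse:
  assumes "g \<in> auto (F n)" "w \<in> carrier (F n)"
  shows "g (inverse w) = inverse (g w)"
  using auto_mult[OF assms(1) assms(2), of "inverse w"] auto_one[OF assms(1)]
  by (simp add: free_group_closed assms fgrp_right_inverse fgrp_inverse_unique)

lemma auto_gen_closed: "g \<in> auto (F n) \<Longrightarrow> j \<in> {1..n} \<Longrightarrow> g (gen j) \<in> carrier (F n)"
  by (rule auto_closed[OF _ gen_closed])

lemma mult_AutoGroup:
  "mult (AutoGroup (F n)) g h = compose (carrier (F n)) g h" if "g \<in> auto (F n)" "h \<in> auto (F n)"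
  using that by (simp add: AutoGroup_def BijGroup_def auto_def)

lemma LB_mult: "mult (LB n) = mult (AutoGroup (F n))"
  by (simp add: LB_def)

lemma LB_one: "one (LB n) = one (AutoGroup (F n))"
  by (simp add: LB_def)

lemma tau_gen: "i \<in> {1..n - 1} \<Longrightarrow> j \<in> {1..n} \<Longrightarrow>
    tau n i (gen j) = (if j = i then gen (i + 1) else if j = i + 1 then gen i else gen j)"
  by (simp add: tau_def gen_closed)

lemma sigma_gen: "i \<in> {1..n - 1} \<Longrightarrow> j \<in> {1..n} \<Longrightarrow>
    sigma n i (gen j) = (if j = i then gen i * gen (i + 1) * inverse (gen i)
      else if j = i + 1 then gen i else gen j)"
  by (simp add: sigma_def gen_closed)

lemma rho_gen: "i \<in> {1..n} \<Longrightarrow> j \<in> {1..n} \<Longrightarrow>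
    rho n i (gen j) = (if j = i then inverse (gen i) else gen j)"
  by (simp add: rho_def gen_closed)

lemma sum_of_bool_single: "i \<in> {1..n} \<Longrightarrow> (\<Sum>k=1..n. of_bool (k = (i::nat)) :: 'r :: comm_ring_1) = 1"
  by (simp add: of_bool_def)

section \<open>Fox calculus\<close>

text \<open>Fox calculus with values in a commutative ring, where all generators of the free group are sent to
one unit \<open>t\<close> with inverse \<open>s\<close>. The Burau representation needs it over \<open>\<int>[t, t\<^sup>-\<^sup>1]\<close>, the extended
representation over \<open>\<int>[t, t\<^sup>-\<^sup>1]/(t\<^sup>2 - 1)\<close>, and the comparison of the two uses both at once.\<close>

locale fox_calculus =
  fixes t s :: "'r :: comm_ring_1"
  assumes t_mult_s: "t * s = 1"
begin

primrec word_eps :: "('a \<times> bool) list \<Rightarrow> 'r" where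
  "word_eps [] = 1"
| "word_eps (l # w) = (if snd l then t else s) * word_eps w"

text \<open>The Fox derivative with respect to \<open>k\<close>: the crossed homomorphism \<open>D (u v) = D u + eps(u) D v\<close> with
values \<open>1\<close> and \<open>0\<close> on generators. The value \<open>- s\<close> on an inverse letter is forced by
\<open>D (x x\<^sup>-\<^sup>1) = 0\<close>.\<close>

primrec word_fox :: "('a \<times> bool) list \<Rightarrow> 'a \<Rightarrow> 'r" where
  "word_fox [] k = 0"
| "word_fox (l # w) k = (if fst l = k then if snd l then 1 else - s else 0)
     + (if snd l then t else s) * word_fox w k"

lemma word_eps_append: "word_eps (u @ v) = word_eps u * word_eps v"
  by (induction u) (simp_all add: mult.assoc)

lemma word_fox_append: "word_fox (u @ v) k = word_fox u k + word_eps u * word_fox v k"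
  by (induction u) (simp_all add: algebra_simps)

lemma s_mult_t: "s * t = 1"
  using t_mult_s by (simp add: mult.commute)

lemma t_mult_s_mult: "t * (s * a) = a"
  by (simp add: mult.assoc[symmetric] t_mult_s)

lemma s_mult_t_mult: "s * (t * a) = a"
  by (simp add: mult.assoc[symmetric] s_mult_t)

lemmas unit_simps = t_mult_s s_mult_t t_mult_s_mult s_mult_t_mult

lemma word_eps_cancel: "cancel u v \<Longrightarrow> word_eps u = word_eps v"
  by (auto elim!: cancel.cases simp: word_eps_append unit_simps)

lemma word_fox_cancel: "cancel u v \<Longrightarrow> word_fox u k = word_fox v k"
proof (elim cancel.cases, clarify)
  fix p x b and q :: "('a \<times> bool) list"
  show "word_fox (p @ (x, b) # (x, \<not> b) # q) k = word_fox (p @ q) k"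
    by (cases b) (simp_all add: word_fox_append distrib_left unit_simps)
qed

lemma word_eps_equivclp: "equivclp cancel u v \<Longrightarrow> word_eps u = word_eps v"
  by (induction rule: equivclp_induct) (auto dest: word_eps_cancel)

lemma word_fox_equivclp: "equivclp cancel u v \<Longrightarrow> word_fox u k = word_fox v k"
  by (induction rule: equivclp_induct) (auto dest: word_fox_cancel[of _ _ k])

definition eps :: "'a fgrp \<Rightarrow> 'r" where
  "eps g = word_eps (rep_fgrp g)"

definition fox :: "'a fgrp \<Rightarrow> 'a \<Rightarrow> 'r" where
  "fox g = word_fox (rep_fgrp g)"

lemma rep_abs: "equivclp cancel (rep_fgrp (abs_fgrp w)) w"
  by (metis Quotient3_fgrp Quotient3_rep_abs equivp_def equivp_evquivclp)

lemma eps_abs: "eps (abs_fgrp w) = word_eps w"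
  unfolding eps_def by (rule word_eps_equivclp[OF rep_abs])

lemma fox_abs: "fox (abs_fgrp w) = word_fox w"
  unfolding fox_def by (rule ext) (rule word_fox_equivclp[OF rep_abs])

lemma eps_mult [simp]: "eps (g * h) = eps g * eps h"
  by (induction g rule: fgrp.abs_induct; induction h rule: fgrp.abs_induct)
     (simp add: times_fgrp.abs_eq eps_abs word_eps_append)

lemma fox_mult [simp]: "fox (g * h) k = fox g k + eps g * fox h k"
  by (induction g rule: fgrp.abs_induct; induction h rule: fgrp.abs_induct)
     (simp add: times_fgrp.abs_eq eps_abs fox_abs word_fox_append)

lemma eps_one [simp]: "eps 1 = 1"
  by (simp add: one_fgrp.abs_eq eps_abs)

lemma fox_one [simp]: "fox 1 k = 0"
  by (simp add: one_fgrp.abs_eq fox_abs)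

lemma eps_gen [simp]: "eps (gen x) = t" "eps (inverse (gen x)) = s"
  by (simp_all add: gen.abs_eq inverse_fgrp.abs_eq eps_abs)

lemma fox_gen [simp]:
  "fox (gen x) k = of_bool (k = x)" "fox (inverse (gen x)) k = - s * of_bool (k = x)"
  by (auto simp: gen.abs_eq inverse_fgrp.abs_eq fox_abs)

lemma fox_outside:
  assumes "g \<in> carrier (free_group A)" "k \<notin> A"
  shows "fox g k = 0"
  using assms(1) by (induction rule: free_group_induct) (use assms(2) in auto)

text \<open>The Jacobian matrix of Fox derivatives of \<open>g\<close>, acting on row vectors \<open>u = \<Sum>\<^sub>j u\<^sub>j e\<^sub>j\<close> by
\<open>e\<^sub>j \<mapsto> D (g a\<^sub>j)\<close>, where \<open>D w\<close> is the vector of Fox derivatives of \<open>w\<close>. Vectors are functions on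
all of \<^typ>\<open>nat\<close>; only the entries with index in \<open>{1..n}\<close> enter.\<close>

definition act :: "nat \<Rightarrow> (nat fgrp \<Rightarrow> nat fgrp) \<Rightarrow> (nat \<Rightarrow> 'r) \<Rightarrow> nat \<Rightarrow> 'r" where
  "act n g u k = (\<Sum>j=1..n. u j * fox (g (gen j)) k)"

lemma act_add: "act n g (\<lambda>j. u j + v j) k = act n g u k + act n g v k"
  by (simp add: act_def algebra_simps sum.distrib)

lemma act_diff: "act n g (\<lambda>j. u j - v j) k = act n g u k - act n g v k"
  by (simp add: act_def algebra_simps sum_subtractf)

lemma act_scale: "act n g (\<lambda>j. r * u j) k = r * act n g u k"
  by (simp add: act_def sum_distrib_left mult.assoc)

lemma act_sum: "act n g (\<lambda>j. \<Sum>i\<in>I. u i j) k = (\<Sum>i\<in>I. act n g (u i) k)"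
  by (simp add: act_def sum_distrib_right sum.swap[of _ I])

lemma act_unit: "i \<in> {1..n} \<Longrightarrow> act n g (\<lambda>j. of_bool (j = i)) k = fox (g (gen i)) k"
  unfolding act_def by (subst sum.remove[of _ i]) auto

text \<open>The automorphisms that respect \<^term>\<open>eps\<close> and fix, modulo \<open>d\<close>, the sum of the Fox derivatives of
each generator. The first condition makes the Jacobian multiplicative (lemma \<open>act_mult\<close>); the second
one makes it respect the sum of the entries of a vector modulo \<open>d\<close> (lemma \<open>sum_act_cong\<close>). The
fundamental identity of Fox calculus equates \<open>t - 1\<close> times this sum with \<open>eps (g a\<^sub>j) - 1\<close>, but if
\<open>t - 1\<close> is a zero divisor, that does not determine the sum. The loop braid group satisfies the
condition for \<open>d = 0\<close>, hence for all \<open>d\<close>; the extended group satisfies it for \<open>d = 1 + t\<close> when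
\<open>t\<^sup>2 = 1\<close>.\<close>

definition eps_auts :: "nat \<Rightarrow> 'r \<Rightarrow> (nat fgrp \<Rightarrow> nat fgrp) set" where
  "eps_auts n d = {g \<in> auto (F n). \<forall>j\<in>{1..n}. eps (g (gen j)) = t
     \<and> d dvd (\<Sum>k=1..n. fox (g (gen j)) k) - 1}"

lemma eps_auts_auto: "g \<in> eps_auts n d \<Longrightarrow> g \<in> auto (F n)"
  by (simp add: eps_auts_def)

lemma eps_inverse: "eps g * eps (inverse g) = 1"
  using eps_mult[of g "inverse g"] by (simp add: fgrp_right_inverse)

lemma fox_inverse: "fox (inverse g) k = - (eps (inverse g) * fox g k)"
  using fox_mult[of "inverse g" g k] by (simp add: fgrp_left_inverse add_eq_0_iff)

lemma eps_invariant:
  assumes "g \<in> eps_auts n d" "w \<in> carrier (F n)"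
  shows "eps (g w) = eps w"
proof -
  note g = eps_auts_auto[OF assms(1)]
  have g_gen: "eps (g (gen x)) = t" "eps (inverse (g (gen x))) = s" if "x \<in> {1..n}" for x
  proof -
    show 1: "eps (g (gen x)) = t" using assms(1) that by (simp add: eps_auts_def)
    have "s * (t * eps (inverse (g (gen x)))) = s"
      using eps_inverse[of "g (gen x)"] by (simp add: 1)
    then show "eps (inverse (g (gen x))) = s" by (simp add: unit_simps)
  qed
  from assms(2) have "w \<in> carrier (F n) \<and> eps (g w) = eps w"
    by (induction rule: free_group_induct)
       (auto simp: auto_one[OF g] auto_mult[OF g] auto_inverse[OF g] gen_closed free_group_closed g_gen)
  then show ?thesis ..
qed

text \<open>The chain rule. As \<open>D\<close> is a crossed homomorphism, both sides are crossed homomorphisms in \<open>w\<close> for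
the same scalar action, because \<open>g\<close> respects \<^term>\<open>eps\<close>; and they agree on generators.\<close>

lemma act_fox:
  assumes "g \<in> eps_auts n d" "w \<in> carrier (F n)"
  shows "act n g (fox w) k = fox (g w) k"
proof -
  note g = eps_auts_auto[OF assms(1)]
  have eps: "eps (g (gen x)) = t" "eps (inverse (g (gen x))) = s" if "x \<in> {1..n}" for x
    using eps_invariant[OF assms(1), of "gen x"] eps_invariant[OF assms(1), of "inverse (gen x)"] that
    by (auto simp: gen_closed free_group_closed auto_inverse[OF g])
  from assms(2) have "w \<in> carrier (F n) \<and> act n g (fox w) k = fox (g w) k"
  proof (induction rule: free_group_induct)
    case one
    then show ?case by (simp add: auto_one[OF g] free_group_closed act_def)
  next
    case (gen x h)
    have "act n g (fox (gen x * h)) k = act n g (\<lambda>j. of_bool (j = x) + t * fox h j) k"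
      by (simp add: act_def)
    then show ?case
      using gen by (simp add: act_add act_scale act_unit[of x n] auto_mult[OF g] gen_closed
          free_group_closed eps)
  next
    case (inv x h)
    have "act n g (fox (inverse (gen x) * h)) k
        = act n g (\<lambda>j. s * fox h j - s * of_bool (j = x)) k"
      unfolding act_def by (simp add: algebra_simps)
    then show ?case
      using inv by (simp add: act_diff act_scale act_unit[of x n] auto_mult[OF g] auto_inverse[OF g]
          gen_closed free_group_closed eps fox_inverse)
  qed
  then show ?thesis ..
qed

lemma sum_act_cong:
  assumes "g \<in> eps_auts n d"
  shows "d dvd (\<Sum>k=1..n. act n g u k) - (\<Sum>j=1..n. u j)"
proof -
  have "(\<Sum>k=1..n. act n g u k) = (\<Sum>j=1..n. u j * (\<Sum>k=1..n. fox (g (gen j)) k))"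
    unfolding act_def by (subst sum.swap) (simp add: sum_distrib_left)
  then have "(\<Sum>k=1..n. act n g u k) - (\<Sum>j=1..n. u j)
      = (\<Sum>j=1..n. u j * ((\<Sum>k=1..n. fox (g (gen j)) k) - 1))"
    by (simp add: sum_subtractf right_diff_distrib)
  also have "d dvd \<dots>"
    using assms by (intro dvd_sum dvd_mult) (simp add: eps_auts_def)
  finally show ?thesis .
qed

lemma act_mult:
  assumes "g \<in> eps_auts n d" "h \<in> auto (F n)"
  shows "act n (g \<otimes>\<^bsub>AutoGroup (F n)\<^esub> h) u k = act n g (act n h u) k"
proof -
  have "act n (g \<otimes>\<^bsub>AutoGroup (F n)\<^esub> h) u k = (\<Sum>j=1..n. u j * fox (g (h (gen j))) k)"
    unfolding act_def using assms
    by (intro sum.cong) (simp_all add: mult_AutoGroup eps_auts_auto compose_eq gen_closed)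
  also have "\<dots> = (\<Sum>j=1..n. u j * act n g (fox (h (gen j))) k)"
    using assms by (intro sum.cong refl) (simp add: act_fox auto_gen_closed)
  also have "\<dots> = act n g (\<lambda>i. \<Sum>j=1..n. u j * fox (h (gen j)) i) k"
    by (simp only: act_sum act_scale)
  finally show ?thesis by (simp add: act_def[of n h, abs_def])
qed

lemma act_one:
  assumes "k \<in> {1..n}"
  shows "act n \<one>\<^bsub>AutoGroup (F n)\<^esub> u k = u k"
proof -
  have "act n \<one>\<^bsub>AutoGroup (F n)\<^esub> u k = (\<Sum>j=1..n. u j * of_bool (k = j))"
    unfolding act_def
    by (intro sum.cong) (auto simp: AutoGroup_def BijGroup_def gen_closed)
  also have "\<dots> = u k"
    using assms by (subst sum.remove[of _ k]) (auto intro!: sum.neutral)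
  finally show ?thesis .
qed

lemma act_outside: "g \<in> auto (F n) \<Longrightarrow> k \<notin> {1..n} \<Longrightarrow> act n g u k = 0"
  unfolding act_def
  by (intro sum.neutral ballI) (simp add: fox_outside[OF auto_gen_closed])

text \<open>For closure under inverses, the relative statements \<open>eps_invariant\<close> and \<open>sum_act_cong\<close> about \<open>g\<close> are
applied to the word \<open>g\<^sup>-\<^sup>1 a\<^sub>j\<close>, which \<open>g\<close> maps to \<open>a\<^sub>j\<close>.\<close>

lemma subgroup_eps_auts: "subgroup (eps_auts n d) (AutoGroup (F n))"
proof -
  interpret A: group "AutoGroup (F n)" by (rule group.AutoGroup[OF group_free_group])
  have carr: "eps_auts n d \<subseteq> carrier (AutoGroup (F n))"
    by (auto simp: carrier_AutoGroup eps_auts_def)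
  show ?thesis
  proof (rule A.subgroupI[OF carr])
    have "\<one>\<^bsub>AutoGroup (F n)\<^esub> \<in> eps_auts n d"
      using A.one_closed by (auto simp: eps_auts_def carrier_AutoGroup)
        (auto simp: AutoGroup_def BijGroup_def gen_closed of_bool_def)
    then show "eps_auts n d \<noteq> {}" by blast
  next
    fix g assume g: "g \<in> eps_auts n d"
    let ?h = "inv\<^bsub>AutoGroup (F n)\<^esub> g"
    have h: "?h \<in> auto (F n)" using A.inv_closed[of g] g carr by (auto simp: carrier_AutoGroup)
    have gh: "g \<otimes>\<^bsub>AutoGroup (F n)\<^esub> ?h = \<one>\<^bsub>AutoGroup (F n)\<^esub>" using g carr by auto
    have "eps (?h (gen j)) = t \<and> d dvd (\<Sum>k=1..n. fox (?h (gen j)) k) - 1" if j: "j \<in> {1..n}" for j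
    proof
      have "g (?h (gen j)) = (g \<otimes>\<^bsub>AutoGroup (F n)\<^esub> ?h) (gen j)"
        using g h j by (simp add: mult_AutoGroup eps_auts_auto compose_eq gen_closed)
      also have "\<dots> = gen j"
        unfolding gh using j by (simp add: AutoGroup_def BijGroup_def gen_closed)
      finally have ghj: "g (?h (gen j)) = gen j" .
      have hj: "?h (gen j) \<in> carrier (F n)" by (rule auto_gen_closed[OF h j])
      show "eps (?h (gen j)) = t" using eps_invariant[OF g hj] ghj by simp
      have "(\<Sum>k=1..n. act n g (fox (?h (gen j))) k) = 1"
        using j by (simp add: act_fox[OF g hj] ghj of_bool_def)
      then show "d dvd (\<Sum>k=1..n. fox (?h (gen j)) k) - 1"
        using sum_act_cong[OF g, of "fox (?h (gen j))"] by (metis dvd_minus_iff minus_diff_eq)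
    qed
    with h show "?h \<in> eps_auts n d" by (simp add: eps_auts_def)
  next
    fix g h assume g: "g \<in> eps_auts n d" and h: "h \<in> eps_auts n d"
    let ?p = "g \<otimes>\<^bsub>AutoGroup (F n)\<^esub> h"
    have p: "?p \<in> auto (F n)" using A.m_closed g h carr by (auto simp: carrier_AutoGroup)
    have "eps (?p (gen j)) = t \<and> d dvd (\<Sum>k=1..n. fox (?p (gen j)) k) - 1" if j: "j \<in> {1..n}" for j
    proof -
      have hj: "h (gen j) \<in> carrier (F n)" by (rule auto_gen_closed[OF eps_auts_auto[OF h] j])
      have pj: "?p (gen j) = g (h (gen j))"
        using g h j by (simp add: mult_AutoGroup eps_auts_auto compose_eq gen_closed)
      have "d dvd ((\<Sum>k=1..n. act n g (fox (h (gen j))) k) - (\<Sum>k=1..n. fox (h (gen j)) k))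
          + ((\<Sum>k=1..n. fox (h (gen j)) k) - 1)"
        using sum_act_cong[OF g] h j by (intro dvd_add) (simp_all add: eps_auts_def)
      then show ?thesis
        using h j by (simp add: pj eps_invariant[OF g hj] act_fox[OF g hj] eps_auts_def)
    qed
    with p show "?p \<in> eps_auts n d" by (simp add: eps_auts_def)
  qed
qed

lemma subset_eps_auts:
  assumes "X \<subseteq> eps_auts n d"
  shows "carrier (subgroup_generated (AutoGroup (F n)) X) \<subseteq> eps_auts n d"
  unfolding carrier_subgroup_generated
  by (intro group.generate_subgroup_incl[OF group.AutoGroup[OF group_free_group]] subgroup_eps_auts)
     (use assms in auto)

lemma fox_tau: "i \<in> {1..n - 1} \<Longrightarrow> j \<in> {1..n} \<Longrightarrow>
    fox (tau n i (gen j)) k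
      = of_bool (k = (if j = i then i + 1 else if j = i + 1 then i else j))"
  by (simp add: tau_gen)

lemma fox_sigma: "i \<in> {1..n - 1} \<Longrightarrow> j \<in> {1..n} \<Longrightarrow>
    fox (sigma n i (gen j)) k
      = (if j = i then (1 - t) * of_bool (k = i) + t * of_bool (k = i + 1)
         else of_bool (k = (if j = i + 1 then i else j)))"
  by (simp add: sigma_gen algebra_simps unit_simps)

lemma fox_rho: "i \<in> {1..n} \<Longrightarrow> j \<in> {1..n} \<Longrightarrow>
    fox (rho n i (gen j)) k = (if j = i then - s else 1) * of_bool (k = j)"
  by (simp add: rho_gen)

lemma eps_tau: "i \<in> {1..n - 1} \<Longrightarrow> j \<in> {1..n} \<Longrightarrow> eps (tau n i (gen j)) = t"
  by (simp add: tau_gen)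

lemma eps_sigma: "i \<in> {1..n - 1} \<Longrightarrow> j \<in> {1..n} \<Longrightarrow> eps (sigma n i (gen j)) = t"
  by (simp add: sigma_gen mult.assoc unit_simps)

lemma tau_eps_auts: "i \<in> {1..n - 1} \<Longrightarrow> tau n i \<in> eps_auts n d"
  using generators_in_Aut(1)[of i n]
  by (auto simp: eps_auts_def carrier_AutoGroup eps_tau fox_tau sum_of_bool_single)

lemma sum_fox_sigma:
  assumes "i \<in> {1..n - 1}" "j \<in> {1..n}"
  shows "(\<Sum>k=1..n. fox (sigma n i (gen j)) k) = 1"
proof (cases "j = i")
  case True
  have "i \<in> {1..n}" "i + 1 \<in> {1..n}" using assms by auto
  with True assms show ?thesis
    by (simp add: fox_sigma sum.distrib sum_distrib_left[symmetric] sum_of_bool_single[of i]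
        sum_of_bool_single[of "i + 1"])
next
  case False
  with assms show ?thesis by (auto simp: fox_sigma sum_of_bool_single)
qed

lemma sigma_eps_auts: "i \<in> {1..n - 1} \<Longrightarrow> sigma n i \<in> eps_auts n d"
  using generators_in_Aut(2)[of i n]
  by (auto simp: eps_auts_def carrier_AutoGroup eps_sigma sum_fox_sigma)

lemma LB_eps_auts: "carrier (LB n) \<subseteq> eps_auts n d"
  unfolding LB_def by (rule subset_eps_auts) (auto intro!: tau_eps_auts sigma_eps_auts)

end


section \<open>The reduced Burau representation\<close>

text \<open>The linear map \<open>v \<mapsto> \<Sum>\<^sub>j v\<^sub>j (e\<^sub>j - e\<^sub>j\<^sub>+\<^sub>1)\<close>, which identifies the reduced module with the vectors of
entry sum zero. The entry \<open>v\<^sub>j\<close> with \<open>1 \<le> j < n\<close> is stored at position \<open>j - 1\<close>. Its inverse on vectors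
of entry sum zero is the formation of partial sums.\<close>

definition incl :: "nat \<Rightarrow> 'a :: comm_ring_1 vec \<Rightarrow> nat \<Rightarrow> 'a" where
  "incl n v k = (if 1 \<le> k \<and> k < n then v $ (k - 1) else 0)
     - (if 2 \<le> k \<and> k \<le> n then v $ (k - 2) else 0)"

definition partial_sums :: "nat \<Rightarrow> (nat \<Rightarrow> 'a :: comm_ring_1) \<Rightarrow> 'a vec" where
  "partial_sums n u = vec (n - 1) (\<lambda>i. \<Sum>k=1..i + 1. u k)"

lemma incl_outside: "k \<notin> {1..n} \<Longrightarrow> incl n v k = 0"
  by (auto simp: incl_def)

lemma partial_sums_closed [simp]: "partial_sums n u \<in> carrier_vec (n - 1)"
  by (simp add: partial_sums_def)

lemma partial_sums_cong: "(\<And>k. 1 \<le> k \<Longrightarrow> k < n \<Longrightarrow> u k = u' k) \<Longrightarrow> partial_sums n u = partial_sums n u'"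
  by (rule eq_vecI) (auto simp: partial_sums_def intro!: sum.cong)

lemma sum_incl_upto: "m < n \<Longrightarrow> (\<Sum>k=1..m. incl n v k) = (if m = 0 then 0 else v $ (m - 1))"
  by (induction m) (auto simp: incl_def)

lemma sum_incl: "(\<Sum>k=1..n. incl n v k) = 0"
proof (cases n)
  case (Suc m)
  then show ?thesis using sum_incl_upto[of m n v] by (simp add: incl_def)
qed simp

lemma partial_sums_incl: "v \<in> carrier_vec (n - 1) \<Longrightarrow> partial_sums n (incl n v) = v"
  by (rule eq_vecI) (auto simp: partial_sums_def sum_incl_upto simp del: sum.cl_ivl_Suc)

text \<open>If the entry sum is not zero, then the defect sits in the last coordinate alone. This is what
allows the summand \<open>S/(t - 1)\<close> to be accommodated there later.\<close>

lemma incl_partial_sums: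
  assumes "\<And>k. k \<notin> {1..n} \<Longrightarrow> u k = 0"
  shows "incl n (partial_sums n u) k = u k - of_bool (k = n) * (\<Sum>j=1..n. u j)"
proof -
  have split: "(\<Sum>j=1..Suc m. u j) = (\<Sum>j=1..m. u j) + u (Suc m)" for m by simp
  consider "k \<notin> {1..n}" | "k \<in> {1..n}" "k < n" | "k = n" "1 \<le> n" by fastforce
  then show ?thesis
  proof cases
    case 1
    then show ?thesis using assms[of k] by (cases "n = 0") (auto simp: incl_outside)
  next
    case 2
    then obtain m where "k = Suc m" by (cases k) auto
    with 2 show ?thesis by (cases m) (auto simp: incl_def partial_sums_def One_nat_def)
  next
    case 3
    then obtain m where "n = Suc m" by (cases n) auto
    with 3 show ?thesis by (cases m) (auto simp: incl_def partial_sums_def One_nat_def)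
  qed
qed

lemma incl_add:
  "v \<in> carrier_vec (n - 1) \<Longrightarrow> w \<in> carrier_vec (n - 1) \<Longrightarrow> incl n (v + w) k = incl n v k + incl n w k"
  by (auto simp: incl_def)

lemma incl_smult: "v \<in> carrier_vec (n - 1) \<Longrightarrow> incl n (r \<cdot>\<^sub>v v) k = r * incl n v k"
  by (auto simp: incl_def algebra_simps)

lemma incl_uminus: "v \<in> carrier_vec (n - 1) \<Longrightarrow> incl n (- v) k = - incl n v k"
  by (auto simp: incl_def)

lemma incl_zero: "incl n (0\<^sub>v (n - 1)) k = 0"
  by (auto simp: incl_def)

lemma basis_closed [simp]: "basis n j \<in> carrier_vec (n - 1)"
  by (simp add: basis_def)

lemma incl_basis:
  assumes "j \<in> {1..n - 1}"
  shows "(incl n (basis n j) k :: 'a :: comm_ring_1) = of_bool (k = j) - of_bool (k = j + 1)"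
proof -
  obtain i where i: "j = i + 1" "i < n - 1" using assms by (auto dest: le_Suc_ex)
  have idx: "basis n (i + 1) $ m = (of_bool (m = i) :: 'a)" if "m < n - 1" for m
    using that i(2) by (simp add: basis_def)
  have fst: "(if 1 \<le> k \<and> k < n then basis n j $ (k - 1) else 0) = (of_bool (k = j) :: 'a)"
    unfolding i(1) using i(2) by (cases k) (auto simp: idx )
  have snd: "(if 2 \<le> k \<and> k \<le> n then basis n j $ (k - 2) else 0) = (of_bool (k = j + 1) :: 'a)"
  proof (cases "2 \<le> k")
    case True
    then obtain m where "k = m + 2" by (metis add.commute le_Suc_ex)
    with i show ?thesis by (auto simp: idx)
  qed (use i in auto)
  show ?thesis unfolding incl_def fst snd ..
qed

lemma incl_expand:
  assumes "v \<in> carrier_vec (n - 1)"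
  shows "incl n v k = (\<Sum>j<n - 1. v $ j * incl n (basis n (j + 1)) k)"
proof -
  have pick: "(\<Sum>j<n - 1. v $ j * of_bool (j = m)) = (if m < n - 1 then v $ m else 0)" for m
    by (simp add: of_bool_def if_distrib cong: if_cong)
  have "(\<Sum>j<n - 1. v $ j * incl n (basis n (j + 1)) k)
     = (\<Sum>j<n - 1. v $ j * of_bool (k = j + 1)) - (\<Sum>j<n - 1. v $ j * of_bool (k = j + 2))"
    unfolding sum_subtractf[symmetric]
    by (intro sum.cong refl) (simp add: incl_basis right_diff_distrib)
  also have "(\<Sum>j<n - 1. v $ j * of_bool (k = j + 1)) = (if 1 \<le> k \<and> k < n then v $ (k - 1) else 0)"
    using pick[of "k - 1"] by (cases k) auto
  also have "(\<Sum>j<n - 1. v $ j * of_bool (k = j + 2)) = (if 2 \<le> k \<and> k \<le> n then v $ (k - 2) else 0)"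
  proof (cases "k \<ge> 2")
    case True
    then obtain m where "k = m + 2" using le_Suc_ex[of 2 k] by (auto simp: add.commute)
    then show ?thesis using pick[of m] by auto
  qed auto
  finally show ?thesis by (simp add: incl_def)
qed

context fox_calculus
begin

definition burau :: "nat \<Rightarrow> (nat fgrp \<Rightarrow> nat fgrp) \<Rightarrow> 'r mat" where
  "burau n g = mat (n - 1) (n - 1) (\<lambda>(i, j). partial_sums n (act n g (incl n (basis n (j + 1)))) $ i)"

lemma burau_closed [simp]: "burau n g \<in> carrier_mat (n - 1) (n - 1)"
  by (simp add: burau_def)

lemma burau_mult_vec:
  assumes v: "v \<in> carrier_vec (n - 1)"
  shows "burau n g *\<^sub>v v = partial_sums n (act n g (incl n v))"
proof (rule eq_vecI)
  fix i assume "i < dim_vec (partial_sums n (act n g (incl n v)))"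
  then have i: "i < n - 1" by (simp add: partial_sums_def)
  have act: "act n g (incl n v) k = (\<Sum>j<n - 1. v $ j * act n g (incl n (basis n (j + 1))) k)" for k
    unfolding act_scale[symmetric] act_sum[symmetric] incl_expand[OF v, symmetric] by simp
  have "(burau n g *\<^sub>v v) $ i
      = (\<Sum>j<n - 1. (\<Sum>k=1..i + 1. act n g (incl n (basis n (j + 1))) k) * v $ j)"
    using i v by (simp add: burau_def scalar_prod_def partial_sums_def atLeast0LessThan del: sum.cl_ivl_Suc)
  also have "\<dots> = (\<Sum>k=1..i + 1. act n g (incl n v) k)"
    unfolding act by (subst sum.swap) (simp add: sum_distrib_left mult.commute)
  finally show "(burau n g *\<^sub>v v) $ i = partial_sums n (act n g (incl n v)) $ i"
    using i by (simp add: partial_sums_def)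
qed (simp add: burau_def partial_sums_def)

text \<open>With \<open>d = 0\<close> the Jacobian preserves the vectors of entry sum zero, and the matrix describes it
there.\<close>

lemma incl_burau:
  assumes "g \<in> eps_auts n 0" "v \<in> carrier_vec (n - 1)"
  shows "incl n (burau n g *\<^sub>v v) k = act n g (incl n v) k"
proof -
  have "(\<Sum>k=1..n. act n g (incl n v) k) = 0"
    using sum_act_cong[OF assms(1), of "incl n v"] by (simp add: sum_incl)
  then show ?thesis
    using incl_partial_sums[of n "act n g (incl n v)" k, OF act_outside[OF eps_auts_auto[OF assms(1)]]]
    by (simp add: burau_mult_vec[OF assms(2)])
qed

lemma burau_mult:
  assumes "g \<in> eps_auts n 0" "h \<in> eps_auts n 0"
  shows "burau n (g \<otimes>\<^bsub>AutoGroup (F n)\<^esub> h) = burau n g * burau n h"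
proof (rule basis_eqI[of _ n])
  fix j assume "j \<in> {1..n - 1}"
  have "act n h (incl n (basis n j)) = incl n (burau n h *\<^sub>v basis n j)"
    by (rule ext) (simp add: incl_burau[OF assms(2)])
  note act_h = this
  have "act n (g \<otimes>\<^bsub>AutoGroup (F n)\<^esub> h) u = act n g (act n h u)" for u
    by (rule ext) (rule act_mult[OF assms(1) eps_auts_auto[OF assms(2)]])
  then have "burau n (g \<otimes>\<^bsub>AutoGroup (F n)\<^esub> h) *\<^sub>v basis n j
      = partial_sums n (act n g (incl n (burau n h *\<^sub>v basis n j)))"
    by (simp only: burau_mult_vec[OF basis_closed, of n "g \<otimes>\<^bsub>AutoGroup (F n)\<^esub> h"] act_h)
  also have "\<dots> = burau n g *\<^sub>v (burau n h *\<^sub>v basis n j)"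
    by (intro burau_mult_vec[symmetric] mult_mat_vec_carrier[OF burau_closed basis_closed])
  also have "\<dots> = burau n g * burau n h *\<^sub>v basis n j"
    by (rule assoc_mult_mat_vec[symmetric, of _ "n - 1" "n - 1" _ "n - 1"]) simp_all
  finally show "burau n (g \<otimes>\<^bsub>AutoGroup (F n)\<^esub> h) *\<^sub>v basis n j
      = burau n g * burau n h *\<^sub>v basis n j" .
qed (auto intro: mult_carrier_mat[of _ "n - 1" "n - 1" _ "n - 1"])

lemma burau_one: "burau n \<one>\<^bsub>AutoGroup (F n)\<^esub> = 1\<^sub>m (n - 1)"
proof (rule basis_eqI[of _ n])
  fix j assume "j \<in> {1..n - 1}"
  have "burau n \<one>\<^bsub>AutoGroup (F n)\<^esub> *\<^sub>v basis n j = partial_sums n (incl n (basis n j))"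
    by (simp add: burau_mult_vec) (rule partial_sums_cong, simp add: act_one)
  then show "burau n \<one>\<^bsub>AutoGroup (F n)\<^esub> *\<^sub>v basis n j = 1\<^sub>m (n - 1) *\<^sub>v basis n j"
    by (simp add: partial_sums_incl)
qed simp_all

lemma burau_hom: "burau n \<in> hom (LB n) (GL TYPE('r) (n - 1))"
proof (rule homI)
  interpret LB: group "LB n" by (rule group_LB)
  note sub = subsetD[OF LB_eps_auts[of n 0]]
  fix g assume g: "g \<in> carrier (LB n)"
  have "burau n (inv\<^bsub>LB n\<^esub> g) * burau n g = 1\<^sub>m (n - 1)"
      "burau n g * burau n (inv\<^bsub>LB n\<^esub> g) = 1\<^sub>m (n - 1)"
    using LB.l_inv[OF g] LB.r_inv[OF g] g LB.inv_closed[OF g]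
    by (simp_all add: burau_mult[symmetric] sub LB_mult LB_one burau_one)
  then show "burau n g \<in> carrier (GL TYPE('r) (n - 1))"
    by (auto simp: GL_def units_of_carrier Units_def ring_mat_simps intro!: bexI[of _ "burau n (inv\<^bsub>LB n\<^esub> g)"])
next
  fix g h assume "g \<in> carrier (LB n)" "h \<in> carrier (LB n)"
  then show "burau n (g \<otimes>\<^bsub>LB n\<^esub> h) = burau n g \<otimes>\<^bsub>GL TYPE('r) (n - 1)\<^esub> burau n h"
    using LB_eps_auts[of n 0]
    by (auto simp: LB_mult GL_def units_of_mult ring_mat_simps intro!: burau_mult)
qed

lemma act_incl_basis:
  assumes "j \<in> {1..n - 1}"
  shows "act n g (incl n (basis n j)) k = fox (g (gen j)) k - fox (g (gen (j + 1))) k"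
proof -
  have j: "j \<in> {1..n}" "j + 1 \<in> {1..n}" using assms by auto
  have "incl n (basis n j :: 'r vec) = (\<lambda>k. of_bool (k = j) - of_bool (k = j + 1))"
    by (rule ext) (rule incl_basis[OF assms])
  then show ?thesis by (simp only: act_diff act_unit[OF j(1)] act_unit[OF j(2)])
qed

lemma burau_basis:
  assumes "j \<in> {1..n - 1}" "w \<in> carrier_vec (n - 1)"
    and "\<And>k. incl n w k = fox (g (gen j)) k - fox (g (gen (j + 1))) k"
  shows "burau n g *\<^sub>v basis n j = w"
proof -
  have "act n g (incl n (basis n j)) = incl n w"
    using act_incl_basis[OF assms(1)] assms(3) by (simp add: fun_eq_iff)
  then show ?thesis using assms(2) by (simp add: burau_mult_vec partial_sums_incl)
qed

end

interpretation laurent: fox_calculus t_R "Poly_Mapping.single (- 1) 1"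
  by standard (rule t_R_invertible)

interpretation laurent2: fox_calculus t_S t_S
  by standard (rule t_S_square)

text \<open>Membership facts in a form that the simplifier can use as they stand: the subtractions on natural
numbers keep it from deriving them.\<close>

lemma index_facts:
  fixes i n :: nat
  assumes "i \<in> {1..n - 1}"
  shows "i \<in> {1..n - 1}" "i \<in> {1..n}" "i + 1 \<in> {1..n}" "i \<noteq> i + 1"
    and "2 \<le> i \<Longrightarrow> i - 1 \<in> {1..n - 1}" "2 \<le> i \<Longrightarrow> i - 1 \<in> {1..n}"
    and "2 \<le> i \<Longrightarrow> i - 1 + 1 = i" "2 \<le> i \<Longrightarrow> i - 1 \<noteq> i" "2 \<le> i \<Longrightarrow> i - 1 \<noteq> i + 1"
    and "i \<le> n - 2 \<Longrightarrow> i + 1 \<in> {1..n - 1}" "i \<le> n - 2 \<Longrightarrow> i + 1 + 1 \<in> {1..n}"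
  using assms by auto

text \<open>On \<open>x\<^sub>j = e\<^sub>j - e\<^sub>j\<^sub>+\<^sub>1\<close> the Jacobians of the generators give the formulas for the Burau representation;
each formula is an identity between combinations of unit vectors.\<close>

lemma reduced_burau_fox: "reduced_burau n (laurent.burau n)"
proof -
  note simps = incl_basis incl_add incl_smult incl_uminus laurent.fox_tau laurent.fox_sigma
  have tau: "2 \<le> i \<Longrightarrow> laurent.burau n (tau n i) *\<^sub>v basis n (i - 1) = basis n (i - 1) + basis n i"
    "laurent.burau n (tau n i) *\<^sub>v basis n i = - basis n i"
    "i \<le> n - 2 \<Longrightarrow> laurent.burau n (tau n i) *\<^sub>v basis n (i + 1) = basis n i + basis n (i + 1)"
    "j \<in> {1..n - 1} - {i - 1, i, i + 1} \<Longrightarrow> laurent.burau n (tau n i) *\<^sub>v basis n j = basis n j"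
    if i: "i \<in> {1..n - 1}" for i j
  proof -
    show "laurent.burau n (tau n i) *\<^sub>v basis n (i - 1) = basis n (i - 1) + basis n i" if "2 \<le> i"
      by (rule laurent.burau_basis)
         (simp_all add: simps index_facts[OF i] that left_diff_distrib right_diff_distrib del: atLeastAtMost_iff)
    show "laurent.burau n (tau n i) *\<^sub>v basis n i = - basis n i"
      by (rule laurent.burau_basis)
         (simp_all add: simps index_facts[OF i] left_diff_distrib right_diff_distrib del: atLeastAtMost_iff)
    show "laurent.burau n (tau n i) *\<^sub>v basis n (i + 1) = basis n i + basis n (i + 1)" if "i \<le> n - 2"
      by (rule laurent.burau_basis)
         (simp_all add: simps index_facts[OF i] that left_diff_distrib right_diff_distrib del: atLeastAtMost_iff)
    assume "j \<in> {1..n - 1} - {i - 1, i, i + 1}"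
    then have j: "j \<in> {1..n - 1}" "j + 1 \<noteq> i" "j \<noteq> i" "j \<noteq> i + 1" by auto
    show "laurent.burau n (tau n i) *\<^sub>v basis n j = basis n j"
      by (rule laurent.burau_basis)
         (simp_all add: simps index_facts[OF i] index_facts[OF j(1)] j del: atLeastAtMost_iff)
  qed
  have sigma: "2 \<le> i \<Longrightarrow> laurent.burau n (sigma n i) *\<^sub>v basis n (i - 1) = basis n (i - 1) + t_R \<cdot>\<^sub>v basis n i"
    "laurent.burau n (sigma n i) *\<^sub>v basis n i = - (t_R \<cdot>\<^sub>v basis n i)"
    "i \<le> n - 2 \<Longrightarrow> laurent.burau n (sigma n i) *\<^sub>v basis n (i + 1) = basis n i + basis n (i + 1)"
    "j \<in> {1..n - 1} - {i - 1, i, i + 1} \<Longrightarrow> laurent.burau n (sigma n i) *\<^sub>v basis n j = basis n j"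
    if i: "i \<in> {1..n - 1}" for i j
  proof -
    show "laurent.burau n (sigma n i) *\<^sub>v basis n (i - 1) = basis n (i - 1) + t_R \<cdot>\<^sub>v basis n i" if "2 \<le> i"
      by (rule laurent.burau_basis)
         (simp_all add: simps index_facts[OF i] that left_diff_distrib right_diff_distrib del: atLeastAtMost_iff)
    show "laurent.burau n (sigma n i) *\<^sub>v basis n i = - (t_R \<cdot>\<^sub>v basis n i)"
      by (rule laurent.burau_basis)
         (simp_all add: simps index_facts[OF i] left_diff_distrib right_diff_distrib del: atLeastAtMost_iff)
    show "laurent.burau n (sigma n i) *\<^sub>v basis n (i + 1) = basis n i + basis n (i + 1)" if "i \<le> n - 2"
      by (rule laurent.burau_basis)
         (simp_all add: simps index_facts[OF i] that left_diff_distrib right_diff_distrib del: atLeastAtMost_iff)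
    assume "j \<in> {1..n - 1} - {i - 1, i, i + 1}"
    then have j: "j \<in> {1..n - 1}" "j + 1 \<noteq> i" "j \<noteq> i" "j \<noteq> i + 1" by auto
    show "laurent.burau n (sigma n i) *\<^sub>v basis n j = basis n j"
      by (rule laurent.burau_basis)
         (simp_all add: simps index_facts[OF i] index_facts[OF j(1)] j del: atLeastAtMost_iff)
  qed
  show ?thesis
    unfolding reduced_burau_def using laurent.burau_hom tau sigma by blast
qed

interpretation mod2: comm_ring_hom mod2
  by (rule mod2_hom)

lemma mod2_t: "mod2 t_R = t_S"
  by (simp add: t_S_def)

text \<open>Inverses are unique, and \<open>t\<close> is its own inverse modulo \<open>t\<^sup>2 - 1\<close>.\<close>

lemma mod2_t_inverse: "mod2 (Poly_Mapping.single (- 1) 1) = t_S"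
proof -
  have "t_S * mod2 (Poly_Mapping.single (- 1) 1) = 1"
    unfolding mod2_t[symmetric] mod2.hom_mult[symmetric] t_R_invertible by simp
  then have "t_S * (t_S * mod2 (Poly_Mapping.single (- 1) 1)) = t_S" by simp
  then show ?thesis by (simp add: laurent2.unit_simps)
qed

lemma mod2_fox: "mod2 (laurent.fox g k) = laurent2.fox g k"
proof (induction g rule: fgrp.abs_induct)
  case (1 w)
  have "mod2 (laurent.word_fox w k) = laurent2.word_fox w k"
    by (induction w) (auto simp: mod2.hom_add mod2.hom_mult mod2.hom_uminus mod2_t mod2_t_inverse)
  then show ?case by (simp add: laurent.fox_abs laurent2.fox_abs)
qed

lemma mod2_burau: "map_mat mod2 (laurent.burau n g) = laurent2.burau n g"
proof (rule eq_matI)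
  fix i j assume "i < dim_row (laurent2.burau n g)" "j < dim_col (laurent2.burau n g)"
  then have ij: "i < n - 1" "j < n - 1" by (simp_all add: laurent2.burau_def)
  then show "map_mat mod2 (laurent.burau n g) $$ (i, j) = laurent2.burau n g $$ (i, j)"
    using laurent.act_incl_basis[of "j + 1" n g] laurent2.act_incl_basis[of "j + 1" n g]
    by (simp add: laurent.burau_def laurent2.burau_def partial_sums_def mod2.hom_sum mod2.hom_minus mod2_fox
        del: sum.cl_ivl_Suc)
qed (simp_all add: laurent.burau_def laurent2.burau_def)


section \<open>The cyclic module as an ideal\<close>

lemma t_minus_1_dvd_single: "t_R - 1 dvd Poly_Mapping.single k 1 - (1 :: laurent)"
proof (induction k rule: int_induct[of _ 0])
  case base
  then show ?case by simp
next
  case (step1 k)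
  have "Poly_Mapping.single (k + 1) 1 - (1 :: laurent)
      = t_R * (Poly_Mapping.single k 1 - 1) + (t_R - 1)"
    by (simp add: t_R_def mult_single right_diff_distrib add.commute)
  then show ?case using step1 by (metis dvd_add dvd_mult dvd_refl)
next
  case (step2 k)
  have "Poly_Mapping.single (k - 1) 1 - (1 :: laurent)
      = Poly_Mapping.single (- 1) 1 * (Poly_Mapping.single k 1 - 1 - (t_R - 1))"
    by (simp add: t_R_def mult_single right_diff_distrib)
  then show ?case using step2 by (metis dvd_diff dvd_mult dvd_refl)
qed

lemma laurent_cong_int: "\<exists>m. t_R - 1 dvd f - (of_int m :: laurent)"
proof -
  have "Poly_Mapping.keys f \<subseteq> UNIV" by simp
  then show ?thesis
  proof (induction f rule: frag_induction)
    case zero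
    show ?case by (rule exI[of _ 0]) simp
  next
    case (one k)
    show ?case using t_minus_1_dvd_single[of k] by (intro exI[of _ 1]) simp
  next
    case (diff f g)
    then obtain a b where "t_R - 1 dvd f - of_int a" "t_R - 1 dvd g - of_int b" by blast
    then have "t_R - 1 dvd (f - of_int a) - (g - of_int b)" by (rule dvd_diff)
    then have "t_R - 1 dvd (f - g) - of_int (a - b)" by (simp add: algebra_simps)
    then show ?case ..
  qed
qed

lemma augment_of_int: "augment (of_int m) = m"
proof -
  have "augment (of_int m) = (\<Sum>k\<in>{0}. Poly_Mapping.lookup (of_int m :: laurent) k)"
    by (rule augment_superset) (auto simp: in_keys_iff lookup_of_int)
  then show ?thesis by (simp add: lookup_of_int)
qed

lemma laurent2_cong_int: "\<exists>m. t_S - 1 dvd a - (of_int m :: laurent2)"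
proof -
  obtain f where a: "a = mod2 f" unfolding mod2_def by (induction a rule: laurent2.abs_induct) blast
  obtain m h where "f - of_int m = (t_R - 1) * h" using laurent_cong_int[of f] by (auto elim!: dvdE)
  then have "mod2 (f - of_int m) = mod2 ((t_R - 1) * h)" by simp
  then have "a - of_int m = (t_S - 1) * mod2 h"
    by (simp add: a mod2_t mod2.hom_minus mod2.hom_mult mod2.hom_of_int)
  then show ?thesis by (metis dvd_triv_left)
qed

text \<open>Setting \<open>t = 1\<close> turns \<open>(1 + t) m = 0\<close> into \<open>2 m = 0\<close>.\<close>

lemma delta_of_int_eq_0: "delta * of_int m = 0 \<Longrightarrow> m = 0"
proof -
  assume "delta * of_int m = 0"
  then have "mod2 ((1 + t_R) * of_int m) = mod2 0"
    by (simp add: delta_def mod2_t[symmetric] mod2.hom_add mod2.hom_mult mod2.hom_of_int)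
  then have "t_R\<^sup>2 - 1 dvd (1 + t_R) * of_int m"
    by (simp add: mod2_def laurent2.abs_eq_iff)
  then obtain f where "(1 + t_R) * of_int m = (t_R\<^sup>2 - 1) * f" by (elim dvdE)
  then have "t_R * of_int m - (of_int 0 - of_int m) = t_R * (t_R * f) - f"
    by (simp add: algebra_simps power2_eq_square)
  then have "augment (t_R * of_int m - (of_int 0 - of_int m)) = augment (t_R * (t_R * f) - f)"
    by (rule arg_cong)
  then show "m = 0" by (simp only: augment_diff augment_t_mult augment_of_int)
qed

lemma delta_t_minus_1: "delta * (t_S - 1) = 0"
  by (simp add: delta_def algebra_simps t_S_square)

text \<open>Modulo \<open>t - 1\<close> every element is an integer \<open>m\<close>, and \<open>\<delta> (t - 1) = 0\<close>; so \<open>\<delta> a = \<delta> m\<close>, which vanishes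
only for \<open>m = 0\<close>.\<close>

lemma delta_annihilator: "delta * a = 0 \<Longrightarrow> t_S - 1 dvd a"
proof -
  assume 0: "delta * a = 0"
  obtain m h where "a - of_int m = (t_S - 1) * h" using laurent2_cong_int[of a] by (auto elim!: dvdE)
  then have a: "a = of_int m + (t_S - 1) * h" by (simp add: algebra_simps)
  have "delta * of_int m = 0"
    using 0 delta_t_minus_1 unfolding a by (simp add: distrib_left mult.assoc[symmetric])
  then have "m = 0" by (rule delta_of_int_eq_0)
  with a show ?thesis by simp
qed

text \<open>Multiplication by \<open>\<delta>\<close> identifies \<open>S/(t - 1)\<close> with the ideal \<open>\<delta> S\<close> of \<open>S\<close>.\<close>

lift_definition delta_mult :: "cyc \<Rightarrow> laurent2" is "\<lambda>a. delta * a"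
proof -
  fix a b assume "t_S - 1 dvd a - b"
  then obtain h where "a - b = (t_S - 1) * h" by (elim dvdE)
  then have "delta * (a - b) = 0" using delta_t_minus_1 by (simp add: mult.assoc[symmetric])
  then show "delta * a = delta * b" by (simp add: right_diff_distrib)
qed

lemma delta_mult_add: "delta_mult (c + d) = delta_mult c + delta_mult d"
  by transfer (simp add: distrib_left)

lemma delta_mult_smult: "delta_mult (cyc_smult r c) = r * delta_mult c"
  by transfer (simp add: algebra_simps)

lemma delta_mult_gen: "delta_mult cyc_gen = delta"
  by transfer simp

lemma delta_mult_zero: "delta_mult 0 = 0"
  by transfer simp

lemma delta_mult_inj: "delta_mult c = delta_mult d \<Longrightarrow> c = d"
  by transfer (auto intro: delta_annihilator simp: right_diff_distrib)

lemma delta_mult_range: "delta dvd a \<longleftrightarrow> (\<exists>c. a = delta_mult c)"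
  by transfer (auto simp: dvd_def)

section \<open>The extended module as a module of vectors\<close>

text \<open>The embedding of \<open>S\<^sup>n\<^sup>-\<^sup>1 \<oplus> S/(t - 1)\<close> into \<open>S\<^sup>n\<close> with \<open>x\<^sub>j \<mapsto> e\<^sub>j - e\<^sub>j\<^sub>+\<^sub>1\<close> and \<open>y \<mapsto> - \<delta> e\<^sub>n\<close>. Its image
consists of the vectors whose entry sum is a multiple of \<open>\<delta>\<close>. The sign at \<open>y\<close> is dictated by the
formula for \<open>\<rho>\<^sub>n\<close>: as \<open>\<rho>\<^sub>n\<close> sends \<open>e\<^sub>n\<close> to \<open>- t e\<^sub>n\<close>, it sends \<open>x\<^sub>n\<^sub>-\<^sub>1\<close> to \<open>e\<^sub>n\<^sub>-\<^sub>1 + t e\<^sub>n = x\<^sub>n\<^sub>-\<^sub>1 + \<delta> e\<^sub>n\<close>.\<close>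

definition emb :: "nat \<Rightarrow> laurent2 vec \<times> cyc \<Rightarrow> nat \<Rightarrow> laurent2" where
  "emb n m k = incl n (fst m) k - of_bool (k = n) * delta_mult (snd m)"

lemma ext_module_simps:
  "carrier (ext_module n) = carrier_vec (n - 1) \<times> UNIV"
  "m \<oplus>\<^bsub>ext_module n\<^esub> m' = (fst m + fst m', snd m + snd m')"
  "r \<odot>\<^bsub>ext_module n\<^esub> m = (r \<cdot>\<^sub>v fst m, cyc_smult r (snd m))"
  "\<zero>\<^bsub>ext_module n\<^esub> = (0\<^sub>v (n - 1), 0)"
  by (simp_all add: ext_module_def direct_sum_def module_vec_def cyc_module_def)

interpretation ext: Module.module class_ring "ext_module n" for n
  by (rule module_ext_module)

lemma emb_add: "m \<in> carrier (ext_module n) \<Longrightarrow> m' \<in> carrier (ext_module n) \<Longrightarrow>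
    emb n (m \<oplus>\<^bsub>ext_module n\<^esub> m') k = emb n m k + emb n m' k"
  by (auto simp: emb_def ext_module_simps incl_add delta_mult_add algebra_simps)

lemma emb_smult: "m \<in> carrier (ext_module n) \<Longrightarrow>
    emb n (r \<odot>\<^bsub>ext_module n\<^esub> m) k = r * emb n m k"
  by (auto simp: emb_def ext_module_simps incl_smult delta_mult_smult algebra_simps)

lemma emb_zero: "emb n \<zero>\<^bsub>ext_module n\<^esub> k = 0"
  by (simp add: emb_def ext_module_simps incl_zero delta_mult_zero)

lemma emb_uminus:
  assumes "m \<in> carrier (ext_module n)"
  shows "emb n (\<ominus>\<^bsub>ext_module n\<^esub> m) k = - emb n m k"
proof -
  have "emb n (\<ominus>\<^bsub>ext_module n\<^esub> m) k + emb n m k = 0"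
    using assms by (simp add: emb_add[symmetric] ext.M.l_neg emb_zero)
  then show ?thesis by (simp add: eq_neg_iff_add_eq_0)
qed

lemma emb_minus: "m \<in> carrier (ext_module n) \<Longrightarrow> m' \<in> carrier (ext_module n) \<Longrightarrow>
    emb n (m \<ominus>\<^bsub>ext_module n\<^esub> m') k = emb n m k - emb n m' k"
  by (simp add: a_minus_def emb_add emb_uminus)

lemma emb_finsum: "finite I \<Longrightarrow> f \<in> I \<rightarrow> carrier (ext_module n) \<Longrightarrow>
    emb n (\<Oplus>\<^bsub>ext_module n\<^esub>i\<in>I. f i) k = (\<Sum>i\<in>I. emb n (f i) k)"
proof (induction I rule: finite_induct)
  case empty
  then show ?case by (simp add: emb_zero)
next
  case (insert i I)
  then have "f \<in> I \<rightarrow> carrier (ext_module n)" "f i \<in> carrier (ext_module n)" by auto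
  with insert show ?case by (simp add: ext.M.finsum_insert emb_add ext.M.finsum_closed)
qed

lemma sum_emb: "n \<ge> 1 \<Longrightarrow> (\<Sum>k=1..n. emb n m k) = - delta_mult (snd m)"
  by (simp add: emb_def sum_subtractf sum_incl sum_distrib_right[symmetric] sum_of_bool_single
      del: sum_of_bool_eq)

text \<open>The entry sum recovers the component in \<open>S/(t - 1)\<close>, since multiplication by \<open>\<delta>\<close> is injective
there; the partial sums recover the rest.\<close>

lemma emb_inj:
  assumes "n \<ge> 1" "m \<in> carrier (ext_module n)" "m' \<in> carrier (ext_module n)"
    and "\<And>k. emb n m k = emb n m' k"
  shows "m = m'"
proof -
  have "(\<Sum>k=1..n. emb n m k) = (\<Sum>k=1..n. emb n m' k)" using assms(4) by simp
  then have snd: "snd m = snd m'"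
    using assms(1) by (auto simp: sum_emb intro: delta_mult_inj)
  with assms(4) have "incl n (fst m) = incl n (fst m')"
    by (auto simp: emb_def fun_eq_iff)
  then have "partial_sums n (incl n (fst m)) = partial_sums n (incl n (fst m'))" by simp
  with assms(2,3) have "fst m = fst m'" by (auto simp: partial_sums_incl ext_module_simps)
  with snd show ?thesis by (simp add: prod_eq_iff)
qed

lemma emb_surj:
  assumes "\<And>k. k \<notin> {1..n} \<Longrightarrow> u k = 0" "delta dvd (\<Sum>k=1..n. u k)"
  shows "\<exists>m\<in>carrier (ext_module n). emb n m = u"
proof -
  obtain c where c: "- (\<Sum>k=1..n. u k) = delta_mult c"
    using assms(2) delta_mult_range dvd_minus_iff by blast
  have "incl n (partial_sums n u) k = u k - of_bool (k = n) * (\<Sum>k=1..n. u k)" for k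
    by (rule incl_partial_sums) (rule assms(1))
  then have "emb n (partial_sums n u, c) = u"
    by (simp add: emb_def fun_eq_iff c[symmetric])
  then show ?thesis by (auto simp: ext_module_simps intro!: bexI[of _ "(partial_sums n u, c)"])
qed

section \<open>The action of the extended loop braid group\<close>

text \<open>The inverse \<open>a\<^sub>i\<^sup>-\<^sup>1\<close> has Fox derivative \<open>- t\<^sup>-\<^sup>1 = - t = 1 - \<delta>\<close>, and its \<^term>\<open>laurent2.eps\<close> is
\<open>t\<^sup>-\<^sup>1 = t\<close>. Both equations need \<open>t\<^sup>2 = 1\<close>: this is why the Burau representation has to be reduced.\<close>

lemma rho_eps_auts: "i \<in> {1..n} \<Longrightarrow> rho n i \<in> laurent2.eps_auts n delta"
proof -
  assume i: "i \<in> {1..n}"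
  have "laurent2.eps (rho n i (gen j)) = t_S
      \<and> delta dvd (\<Sum>k=1..n. laurent2.fox (rho n i (gen j)) k) - 1" if j: "j \<in> {1..n}" for j
  proof (cases "j = i")
    case True
    have "- t_S - 1 = - delta" by (simp add: delta_def)
    with True i show ?thesis
      by (simp add: rho_gen sum_of_bool_single sum_distrib_left[symmetric]
          sum_negf del: minus_add_distrib)
  next
    case False
    with i j show ?thesis by (simp add: rho_gen sum_of_bool_single)
  qed
  with generators_in_Aut(3)[OF i] show ?thesis
    by (simp add: laurent2.eps_auts_def carrier_AutoGroup)
qed

lemma LB_ext_eps_auts: "carrier (LB_ext n) \<subseteq> laurent2.eps_auts n delta"
  unfolding LB_ext_def
  by (rule laurent2.subset_eps_auts)
     (auto intro!: laurent2.tau_eps_auts laurent2.sigma_eps_auts rho_eps_auts)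

text \<open>The Jacobian, transported along the embedding. The restriction to the carrier is needed because
elements of \<^const>\<open>Bij\<close> are extensional functions.\<close>

definition ext_action :: "nat \<Rightarrow> (nat fgrp \<Rightarrow> nat fgrp) \<Rightarrow> laurent2 vec \<times> cyc \<Rightarrow> laurent2 vec \<times> cyc" where
  "ext_action n g = (\<lambda>m\<in>carrier (ext_module n).
     inv_into (carrier (ext_module n)) (emb n) (laurent2.act n g (emb n m)))"

context
  fixes n :: nat
  assumes n: "n \<ge> 1"
begin

lemma ext_action_props:
  assumes g: "g \<in> laurent2.eps_auts n delta" and m: "m \<in> carrier (ext_module n)"
  shows ext_action_closed: "ext_action n g m \<in> carrier (ext_module n)"
    and emb_ext_action: "emb n (ext_action n g m) k = laurent2.act n g (emb n m) k"
proof -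
  let ?u = "laurent2.act n g (emb n m)"
  have "delta dvd (\<Sum>k=1..n. emb n m k)"
    using n by (auto simp: sum_emb delta_mult_range)
  then have "delta dvd ((\<Sum>k=1..n. ?u k) - (\<Sum>k=1..n. emb n m k)) + (\<Sum>k=1..n. emb n m k)"
    by (intro dvd_add laurent2.sum_act_cong[OF g])
  then have "\<exists>m'\<in>carrier (ext_module n). emb n m' = ?u"
    by (intro emb_surj) (simp_all add: laurent2.act_outside[OF laurent2.eps_auts_auto[OF g]])
  then have u: "?u \<in> emb n ` carrier (ext_module n)" by (metis imageI)
  show "ext_action n g m \<in> carrier (ext_module n)"
    unfolding ext_action_def using inv_into_into[OF u] m by simp
  show "emb n (ext_action n g m) k = ?u k"
    unfolding ext_action_def using f_inv_into_f[OF u] m by simp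
qed

lemma ext_action_eqI:
  assumes "g \<in> laurent2.eps_auts n delta" "m \<in> carrier (ext_module n)" "m' \<in> carrier (ext_module n)"
    and "\<And>k. laurent2.act n g (emb n m) k = emb n m' k"
  shows "ext_action n g m = m'"
  by (rule emb_inj[OF n]) (simp_all add: ext_action_closed emb_ext_action assms)

lemma ext_action_linear:
  assumes g: "g \<in> laurent2.eps_auts n delta"
  shows "ext_action n g \<in> module_hom class_ring (ext_module n) (ext_module n)"
  unfolding LinearCombinations.module_hom_def
proof (intro CollectI conjI allI impI)
  show "ext_action n g \<in> carrier (ext_module n) \<rightarrow> carrier (ext_module n)"
    by (auto intro: ext_action_closed[OF g])
next
  fix m m' assume m: "m \<in> carrier (ext_module n) \<and> m' \<in> carrier (ext_module n)"
  then have "emb n (m \<oplus>\<^bsub>ext_module n\<^esub> m') = (\<lambda>k. emb n m k + emb n m' k)"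
    by (intro ext emb_add) auto
  with m show "ext_action n g (m \<oplus>\<^bsub>ext_module n\<^esub> m')
      = ext_action n g m \<oplus>\<^bsub>ext_module n\<^esub> ext_action n g m'"
    by (intro ext_action_eqI[OF g])
       (simp_all add: ext_action_closed[OF g] emb_ext_action[OF g] emb_add laurent2.act_add)
next
  fix r :: laurent2 and m assume m: "r \<in> carrier class_ring \<and> m \<in> carrier (ext_module n)"
  then have "emb n (r \<odot>\<^bsub>ext_module n\<^esub> m) = (\<lambda>k. r * emb n m k)"
    by (intro ext emb_smult) auto
  with m show "ext_action n g (r \<odot>\<^bsub>ext_module n\<^esub> m) = r \<odot>\<^bsub>ext_module n\<^esub> ext_action n g m"
    by (intro ext_action_eqI[OF g])
       (simp_all add: ext_action_closed[OF g] emb_ext_action[OF g] emb_smult laurent2.act_scale)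
qed

lemma ext_action_mult:
  assumes g: "g \<in> laurent2.eps_auts n delta" and h: "h \<in> laurent2.eps_auts n delta"
  shows "ext_action n (g \<otimes>\<^bsub>AutoGroup (F n)\<^esub> h)
    = compose (carrier (ext_module n)) (ext_action n g) (ext_action n h)"
proof
  fix m
  show "ext_action n (g \<otimes>\<^bsub>AutoGroup (F n)\<^esub> h) m
    = compose (carrier (ext_module n)) (ext_action n g) (ext_action n h) m"
  proof (cases "m \<in> carrier (ext_module n)")
    case True
    have "emb n (ext_action n h m) = laurent2.act n h (emb n m)"
      by (rule ext) (rule emb_ext_action[OF h True])
    then have "ext_action n (g \<otimes>\<^bsub>AutoGroup (F n)\<^esub> h) m = ext_action n g (ext_action n h m)"
      using subgroup.m_closed[OF laurent2.subgroup_eps_auts g h] True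
      by (intro ext_action_eqI)
         (simp_all add: ext_action_closed g h emb_ext_action laurent2.act_mult[OF g]
           laurent2.eps_auts_auto[OF h])
    then show ?thesis using True by (simp add: compose_eq)
  qed (simp add: ext_action_def compose_def)
qed

lemma ext_action_one:
  assumes m: "m \<in> carrier (ext_module n)"
  shows "ext_action n \<one>\<^bsub>AutoGroup (F n)\<^esub> m = m"
proof (rule ext_action_eqI)
  show "laurent2.act n \<one>\<^bsub>AutoGroup (F n)\<^esub> (emb n m) k = emb n m k" for k
  proof (cases "k \<in> {1..n}")
    case False
    then have "emb n m k = 0" using n by (auto simp: emb_def incl_outside)
    with False show ?thesis
      using laurent2.act_outside[OF laurent2.eps_auts_auto[OF subgroup.one_closed[OF
          laurent2.subgroup_eps_auts]]] by simp
  qed (rule laurent2.act_one)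
qed (use m subgroup.one_closed[OF laurent2.subgroup_eps_auts] in auto)

lemma ext_action_mod_Aut:
  assumes g: "g \<in> laurent2.eps_auts n delta"
  shows "ext_action n g \<in> carrier (mod_Aut class_ring (ext_module n))"
proof -
  let ?A = "AutoGroup (F n)"
  interpret A: group ?A by (rule group.AutoGroup[OF group_free_group])
  interpret E: subgroup "laurent2.eps_auts n delta" ?A by (rule laurent2.subgroup_eps_auts)
  let ?h = "inv\<^bsub>?A\<^esub> g"
  have h: "?h \<in> laurent2.eps_auts n delta" using g by (rule E.m_inv_closed)
  have inv: "ext_action n g (ext_action n ?h m) = m" "ext_action n ?h (ext_action n g m) = m"
    if "m \<in> carrier (ext_module n)" for m
    using that ext_action_mult[OF g h] ext_action_mult[OF h g] ext_action_one[OF that]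
      A.r_inv[OF E.mem_carrier[OF g]] A.l_inv[OF E.mem_carrier[OF g]]
    by (metis compose_eq)+
  have "bij_betw (ext_action n g) (carrier (ext_module n)) (carrier (ext_module n))"
    by (rule bij_betw_byWitness[where f' = "ext_action n ?h"])
       (auto simp: inv ext_action_closed[OF g] ext_action_closed[OF h])
  then show ?thesis
    using ext_action_linear[OF g] by (simp add: mod_Aut_def Bij_def) (simp add: ext_action_def)
qed

lemma ext_action_hom: "ext_action n \<in> hom (LB_ext n) (mod_Aut class_ring (ext_module n))"
proof (rule homI)
  fix g h assume gh: "g \<in> carrier (LB_ext n)" "h \<in> carrier (LB_ext n)"
  note E = subsetD[OF LB_ext_eps_auts[of n]]
  show "ext_action n g \<in> carrier (mod_Aut class_ring (ext_module n))"
    using gh by (intro ext_action_mod_Aut E)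
  have "ext_action n g \<in> Bij (carrier (ext_module n))" "ext_action n h \<in> Bij (carrier (ext_module n))"
    using gh[THEN E, THEN ext_action_mod_Aut] by (simp_all add: mod_Aut_def)
  then show "ext_action n (g \<otimes>\<^bsub>LB_ext n\<^esub> h)
      = ext_action n g \<otimes>\<^bsub>mod_Aut class_ring (ext_module n)\<^esub> ext_action n h"
    using gh by (simp add: mod_Aut_def BijGroup_def LB_ext_def[THEN arg_cong[where f = mult]]
        ext_action_mult[OF E E])
qed

text \<open>Vectors of entry sum zero are exactly the embedded pairs \<open>(v, 0)\<close>, and on them both sides are the
Jacobian over \<open>S\<close>.\<close>

lemma ext_action_restrict:
  assumes g: "g \<in> carrier (LB n)" and v: "v \<in> carrier_vec (n - 1)"
  shows "ext_action n g (v, 0) = (map_mat mod2 (laurent.burau n g) *\<^sub>v v, 0)"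
proof (rule ext_action_eqI)
  show "g \<in> laurent2.eps_auts n delta" using laurent2.LB_eps_auts g by blast
  have g0: "g \<in> laurent2.eps_auts n 0" using laurent2.LB_eps_auts g by blast
  have emb: "emb n (w, 0) = incl n w" for w by (simp add: emb_def fun_eq_iff delta_mult_zero)
  show "laurent2.act n g (emb n (v, 0)) k = emb n (map_mat mod2 (laurent.burau n g) *\<^sub>v v, 0) k" for k
    unfolding emb mod2_burau using laurent2.incl_burau[OF g0 v] by simp
qed (use v in \<open>auto simp: ext_module_simps mod2_burau mult_mat_vec_carrier[OF laurent2.burau_closed]\<close>)

end

lemma x_gen_closed [simp]: "x_gen n j \<in> carrier (ext_module n)"
  by (simp add: x_gen_def ext_module_simps)

lemma y_gen_closed [simp]: "y_gen n \<in> carrier (ext_module n)"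
  by (simp add: y_gen_def ext_module_simps)

lemma emb_x_gen: "j \<in> {1..n - 1} \<Longrightarrow> emb n (x_gen n j) k = of_bool (k = j) - of_bool (k = j + 1)"
  by (simp add: emb_def x_gen_def incl_basis delta_mult_zero)

lemma emb_y_gen: "emb n (y_gen n) k = - delta * of_bool (k = n)"
  by (simp add: emb_def y_gen_def incl_zero delta_mult_gen)

text \<open>A telescoping sum. The case \<open>i = n\<close>, where it is empty, is needed for \<open>\<rho>\<^sub>n\<^sub>-\<^sub>1\<close>.\<close>

lemma emb_sum_x_gen:
  assumes "i \<in> {1..n}"
  shows "emb n (\<Oplus>\<^bsub>ext_module n\<^esub>j\<in>{i..n - 1}. x_gen n j) k = of_bool (k = i) - of_bool (k = n)"
proof -
  have "emb n (\<Oplus>\<^bsub>ext_module n\<^esub>j\<in>{i..n - 1}. x_gen n j) k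
      = (\<Sum>j=i..n - 1. of_bool (k = j) - of_bool (k = Suc j))"
    using assms by (simp add: emb_finsum) (intro sum.cong refl, simp add: emb_x_gen)
  also have "\<dots> = of_bool (k = i) - of_bool (k = n)"
  proof (cases "i = n")
    case False
    with assms show ?thesis
      using sum_Suc_diff[of i "n - 1" "\<lambda>j. - (of_bool (k = j) :: laurent2)"] by simp
  qed (use assms in auto)
  finally show ?thesis .
qed

lemma act_emb_x_gen:
  assumes "j \<in> {1..n - 1}"
  shows "laurent2.act n g (emb n (x_gen n j)) k
    = laurent2.fox (g (gen j)) k - laurent2.fox (g (gen (j + 1))) k"
proof -
  have "emb n (x_gen n j) = incl n (basis n j)"
    by (rule ext) (simp add: emb_def x_gen_def delta_mult_zero)
  then show ?thesis by (simp only: laurent2.act_incl_basis[OF assms])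
qed

lemma act_emb_y_gen:
  assumes "n \<in> {1..n}"
  shows "laurent2.act n g (emb n (y_gen n)) k = - delta * laurent2.fox (g (gen n)) k"
proof -
  have "emb n (y_gen n) = (\<lambda>k. - delta * of_bool (k = n))"
    by (rule ext) (rule emb_y_gen)
  then show ?thesis by (simp only: laurent2.act_scale laurent2.act_unit[OF assms])
qed

lemma finsum_x_gen_closed [simp]: "(\<Oplus>\<^bsub>ext_module n\<^esub>j\<in>I. x_gen n j) \<in> carrier (ext_module n)"
  by (rule ext.M.finsum_closed) simp

lemmas emb_simps = emb_add emb_smult emb_uminus emb_minus emb_x_gen emb_y_gen emb_sum_x_gen
  act_emb_x_gen act_emb_y_gen

lemma delta_t_S: "delta * t_S = delta"
  by (simp add: delta_def algebra_simps t_S_square)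

text \<open>The formulas on generators. Since the embedding is injective and linear, each of them is verified
after embedding, where it compares Fox derivatives of images of generators with combinations of
unit vectors.\<close>

lemma ext_action_tau:
  assumes i: "i \<in> {1..n - 1}"
  defines "M \<equiv> ext_module n" and "x \<equiv> x_gen n" and "y \<equiv> y_gen n"
  shows "2 \<le> i \<Longrightarrow> ext_action n (tau n i) (x (i - 1)) = x (i - 1) \<oplus>\<^bsub>M\<^esub> x i"
    and "ext_action n (tau n i) (x i) = \<ominus>\<^bsub>M\<^esub> x i"
    and "i \<le> n - 2 \<Longrightarrow> ext_action n (tau n i) (x (i + 1)) = x i \<oplus>\<^bsub>M\<^esub> x (i + 1)"
    and "j \<in> {1..n - 1} - {i - 1, i, i + 1} \<Longrightarrow> ext_action n (tau n i) (x j) = x j"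
    and "ext_action n (tau n i) y = (if i = n - 1 then y \<ominus>\<^bsub>M\<^esub> delta \<odot>\<^bsub>M\<^esub> x (n - 1) else y)"
proof -
  have n: "n \<ge> 1" and n_mem: "n \<in> {1..n}" using i by auto
  note mem = laurent2.tau_eps_auts[OF i]
  note gen_simps = emb_simps laurent2.fox_tau left_diff_distrib right_diff_distrib distrib_left distrib_right
  show "ext_action n (tau n i) (x (i - 1)) = x (i - 1) \<oplus>\<^bsub>M\<^esub> x i" if "2 \<le> i"
    unfolding M_def x_def y_def
    by (rule ext_action_eqI[OF n mem])
       (simp_all add: gen_simps index_facts[OF i] n_mem that del: atLeastAtMost_iff)
  show "ext_action n (tau n i) (x i) = \<ominus>\<^bsub>M\<^esub> x i"
    unfolding M_def x_def y_def
    by (rule ext_action_eqI[OF n mem])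
       (simp_all add: gen_simps index_facts[OF i] n_mem del: atLeastAtMost_iff)
  show "ext_action n (tau n i) (x (i + 1)) = x i \<oplus>\<^bsub>M\<^esub> x (i + 1)" if "i \<le> n - 2"
    unfolding M_def x_def y_def
    by (rule ext_action_eqI[OF n mem])
       (simp_all add: gen_simps index_facts[OF i] n_mem that del: atLeastAtMost_iff)
  show "ext_action n (tau n i) y = (if i = n - 1 then y \<ominus>\<^bsub>M\<^esub> delta \<odot>\<^bsub>M\<^esub> x (n - 1) else y)"
  proof (cases "i = n - 1")
    case True
    then have n_eq: "i + 1 = n" "n \<noteq> i" using i by auto
    show ?thesis
      unfolding M_def x_def y_def if_P[OF True] True[symmetric]
      by (rule ext_action_eqI[OF n mem])
         (simp_all add: gen_simps index_facts[OF i] n_mem n_eq delta_t_S mult.assoc[symmetric]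
           del: atLeastAtMost_iff)
  next
    case False
    with i have "n \<noteq> i" "n \<noteq> i + 1" by auto
    with False show ?thesis
      unfolding M_def x_def y_def if_not_P[OF False]
      by (intro ext_action_eqI[OF n mem])
         (simp_all add: gen_simps index_facts[OF i] n_mem del: atLeastAtMost_iff)
  qed
  assume "j \<in> {1..n - 1} - {i - 1, i, i + 1}"
  then have j: "j \<in> {1..n - 1}" "j + 1 \<noteq> i" "j \<noteq> i" "j \<noteq> i + 1" by auto
  show "ext_action n (tau n i) (x j) = x j"
    unfolding M_def x_def y_def
    by (rule ext_action_eqI[OF n mem])
       (simp_all add: gen_simps index_facts[OF i] n_mem index_facts[OF j(1)] j del: atLeastAtMost_iff)
qed

lemma ext_action_sigma:
  assumes i: "i \<in> {1..n - 1}"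
  defines "M \<equiv> ext_module n" and "x \<equiv> x_gen n" and "y \<equiv> y_gen n"
  shows "2 \<le> i \<Longrightarrow> ext_action n (sigma n i) (x (i - 1)) = x (i - 1) \<oplus>\<^bsub>M\<^esub> t_S \<odot>\<^bsub>M\<^esub> x i"
    and "ext_action n (sigma n i) (x i) = \<ominus>\<^bsub>M\<^esub> (t_S \<odot>\<^bsub>M\<^esub> x i)"
    and "i \<le> n - 2 \<Longrightarrow> ext_action n (sigma n i) (x (i + 1)) = x i \<oplus>\<^bsub>M\<^esub> x (i + 1)"
    and "j \<in> {1..n - 1} - {i - 1, i, i + 1} \<Longrightarrow> ext_action n (sigma n i) (x j) = x j"
    and "ext_action n (sigma n i) y = (if i = n - 1 then y \<ominus>\<^bsub>M\<^esub> delta \<odot>\<^bsub>M\<^esub> x (n - 1) else y)"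
proof -
  have n: "n \<ge> 1" and n_mem: "n \<in> {1..n}" using i by auto
  note mem = laurent2.sigma_eps_auts[OF i]
  note gen_simps = emb_simps laurent2.fox_sigma left_diff_distrib right_diff_distrib distrib_left distrib_right
  show "ext_action n (sigma n i) (x (i - 1)) = x (i - 1) \<oplus>\<^bsub>M\<^esub> t_S \<odot>\<^bsub>M\<^esub> x i" if "2 \<le> i"
    unfolding M_def x_def y_def
    by (rule ext_action_eqI[OF n mem])
       (simp_all add: gen_simps index_facts[OF i] n_mem that del: atLeastAtMost_iff)
  show "ext_action n (sigma n i) (x i) = \<ominus>\<^bsub>M\<^esub> (t_S \<odot>\<^bsub>M\<^esub> x i)"
    unfolding M_def x_def y_def
    by (rule ext_action_eqI[OF n mem])
       (simp_all add: gen_simps index_facts[OF i] n_mem del: atLeastAtMost_iff)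
  show "ext_action n (sigma n i) (x (i + 1)) = x i \<oplus>\<^bsub>M\<^esub> x (i + 1)" if "i \<le> n - 2"
    unfolding M_def x_def y_def
    by (rule ext_action_eqI[OF n mem])
       (simp_all add: gen_simps index_facts[OF i] n_mem that del: atLeastAtMost_iff)
  show "ext_action n (sigma n i) y = (if i = n - 1 then y \<ominus>\<^bsub>M\<^esub> delta \<odot>\<^bsub>M\<^esub> x (n - 1) else y)"
  proof (cases "i = n - 1")
    case True
    then have n_eq: "i + 1 = n" "n \<noteq> i" using i by auto
    show ?thesis
      unfolding M_def x_def y_def if_P[OF True] True[symmetric]
      by (rule ext_action_eqI[OF n mem])
         (simp_all add: gen_simps index_facts[OF i] n_mem n_eq delta_t_S mult.assoc[symmetric]
           del: atLeastAtMost_iff)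
  next
    case False
    with i have "n \<noteq> i" "n \<noteq> i + 1" by auto
    with False show ?thesis
      unfolding M_def x_def y_def if_not_P[OF False]
      by (intro ext_action_eqI[OF n mem])
         (simp_all add: gen_simps index_facts[OF i] n_mem del: atLeastAtMost_iff)
  qed
  assume "j \<in> {1..n - 1} - {i - 1, i, i + 1}"
  then have j: "j \<in> {1..n - 1}" "j + 1 \<noteq> i" "j \<noteq> i" "j \<noteq> i + 1" by auto
  show "ext_action n (sigma n i) (x j) = x j"
    unfolding M_def x_def y_def
    by (rule ext_action_eqI[OF n mem])
       (simp_all add: gen_simps index_facts[OF i] n_mem index_facts[OF j(1)] j del: atLeastAtMost_iff)
qed

lemma ext_action_rho:
  assumes i: "i \<in> {1..n - 1}"
  defines "M \<equiv> ext_module n" and "x \<equiv> x_gen n" and "y \<equiv> y_gen n"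
  shows "2 \<le> i \<Longrightarrow> ext_action n (rho n i) (x (i - 1))
      = (x (i - 1) \<oplus>\<^bsub>M\<^esub> delta \<odot>\<^bsub>M\<^esub> (\<Oplus>\<^bsub>M\<^esub>j\<in>{i..n - 1}. x j)) \<ominus>\<^bsub>M\<^esub> y"
    and "ext_action n (rho n i) (x i)
      = (\<ominus>\<^bsub>M\<^esub> (t_S \<odot>\<^bsub>M\<^esub> x i) \<ominus>\<^bsub>M\<^esub> delta \<odot>\<^bsub>M\<^esub> (\<Oplus>\<^bsub>M\<^esub>j\<in>{i + 1..n - 1}. x j)) \<oplus>\<^bsub>M\<^esub> y"
    and "j \<in> {1..n - 1} - {i - 1, i} \<Longrightarrow> ext_action n (rho n i) (x j) = x j"
    and "ext_action n (rho n i) y = y"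
proof -
  have n: "n \<ge> 1" and n_mem: "n \<in> {1..n}" and "n \<noteq> i" using i by auto
  note mem = rho_eps_auts[OF index_facts(2)[OF i]]
  note gen_simps = emb_simps laurent2.fox_rho delta_def left_diff_distrib right_diff_distrib distrib_left distrib_right
  show "ext_action n (rho n i) (x (i - 1))
      = (x (i - 1) \<oplus>\<^bsub>M\<^esub> delta \<odot>\<^bsub>M\<^esub> (\<Oplus>\<^bsub>M\<^esub>j\<in>{i..n - 1}. x j)) \<ominus>\<^bsub>M\<^esub> y" if "2 \<le> i"
    unfolding M_def x_def y_def
    by (rule ext_action_eqI[OF n mem])
       (simp_all add: gen_simps index_facts[OF i] n_mem that \<open>n \<noteq> i\<close> del: atLeastAtMost_iff)
  show "ext_action n (rho n i) (x i)
      = (\<ominus>\<^bsub>M\<^esub> (t_S \<odot>\<^bsub>M\<^esub> x i) \<ominus>\<^bsub>M\<^esub> delta \<odot>\<^bsub>M\<^esub> (\<Oplus>\<^bsub>M\<^esub>j\<in>{i + 1..n - 1}. x j)) \<oplus>\<^bsub>M\<^esub> y"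
    unfolding M_def x_def y_def
    by (rule ext_action_eqI[OF n mem])
       (simp_all add: gen_simps index_facts[OF i] n_mem \<open>n \<noteq> i\<close> del: atLeastAtMost_iff)
  show "ext_action n (rho n i) y = y"
    unfolding M_def x_def y_def
    by (rule ext_action_eqI[OF n mem])
       (simp_all add: gen_simps index_facts[OF i] n_mem \<open>n \<noteq> i\<close> del: atLeastAtMost_iff)
  assume "j \<in> {1..n - 1} - {i - 1, i}"
  then have j: "j \<in> {1..n - 1}" "j + 1 \<noteq> i" "j \<noteq> i" by auto
  show "ext_action n (rho n i) (x j) = x j"
    unfolding M_def x_def y_def
    by (rule ext_action_eqI[OF n mem])
       (simp_all add: gen_simps index_facts[OF i] n_mem index_facts[OF j(1)] j del: atLeastAtMost_iff)
qed

lemma ext_action_rho_last: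
  assumes n: "n \<ge> 1"
  defines "M \<equiv> ext_module n" and "x \<equiv> x_gen n" and "y \<equiv> y_gen n"
  shows "n \<ge> 2 \<Longrightarrow> ext_action n (rho n n) (x (n - 1)) = x (n - 1) \<ominus>\<^bsub>M\<^esub> y"
    and "j \<in> {1..n - 1} - {n - 1} \<Longrightarrow> ext_action n (rho n n) (x j) = x j"
    and "ext_action n (rho n n) y = \<ominus>\<^bsub>M\<^esub> y"
proof -
  have n_mem: "n \<in> {1..n}" using n by auto
  note mem = rho_eps_auts[OF n_mem]
  note gen_simps = emb_simps laurent2.fox_rho delta_def t_S_square left_diff_distrib right_diff_distrib distrib_left distrib_right
  show "ext_action n (rho n n) (x (n - 1)) = x (n - 1) \<ominus>\<^bsub>M\<^esub> y" if "n \<ge> 2"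
  proof -
    have i: "n - 1 \<in> {1..n - 1}" "n - 1 + 1 = n" "n - 1 \<noteq> n" using that by auto
    show ?thesis
      unfolding M_def x_def y_def
      by (rule ext_action_eqI[OF n mem])
         (simp_all add: gen_simps index_facts[OF i(1)] i n_mem del: atLeastAtMost_iff)
  qed
  show "ext_action n (rho n n) y = \<ominus>\<^bsub>M\<^esub> y"
    unfolding M_def x_def y_def
    by (rule ext_action_eqI[OF n mem])
       (simp_all add: gen_simps n_mem del: atLeastAtMost_iff)
  assume "j \<in> {1..n - 1} - {n - 1}"
  then have j: "j \<in> {1..n - 1}" "j + 1 \<noteq> n" "j \<noteq> n" by auto
  show "ext_action n (rho n n) (x j) = x j"
    unfolding M_def x_def y_def
    by (rule ext_action_eqI[OF n mem])
       (simp_all add: gen_simps index_facts[OF j(1)] j n_mem del: atLeastAtMost_iff)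
qed

theorem theorem3:
  fixes n :: nat
  assumes "n \<ge> 1"
  shows "\<exists>\<beta> \<Psi> \<Phi>.
    reduced_burau n \<beta> \<and>
    \<Psi> \<in> hom (LB n) (mod_Aut class_ring (ext_module n)) \<and>
    (\<forall>g\<in>carrier (LB n). \<forall>v\<in>carrier_vec (n - 1).
       \<Psi> g (v, 0) = (map_mat mod2 (\<beta> g) *\<^sub>v v, 0)) \<and>
    \<Phi> \<in> hom (LB_ext n) (mod_Aut class_ring (ext_module n)) \<and>
    (\<forall>g\<in>carrier (LB n). \<Phi> g = \<Psi> g) \<and>
    (let M = ext_module n; x = x_gen n; y = y_gen n in
      (\<forall>i\<in>{1..n - 1}.
         (i \<ge> 2 \<longrightarrow> \<Phi> (tau n i) (x (i - 1)) = x (i - 1) \<oplus>\<^bsub>M\<^esub> x i) \<and>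
         \<Phi> (tau n i) (x i) = \<ominus>\<^bsub>M\<^esub> x i \<and>
         (i \<le> n - 2 \<longrightarrow> \<Phi> (tau n i) (x (i + 1)) = x i \<oplus>\<^bsub>M\<^esub> x (i + 1)) \<and>
         (\<forall>j\<in>{1..n - 1} - {i - 1, i, i + 1}. \<Phi> (tau n i) (x j) = x j) \<and>
         \<Phi> (tau n i) y = (if i = n - 1 then y \<ominus>\<^bsub>M\<^esub> delta \<odot>\<^bsub>M\<^esub> x (n - 1) else y)) \<and>
      (\<forall>i\<in>{1..n - 1}.
         (i \<ge> 2 \<longrightarrow> \<Phi> (sigma n i) (x (i - 1)) = x (i - 1) \<oplus>\<^bsub>M\<^esub> t_S \<odot>\<^bsub>M\<^esub> x i) \<and>
         \<Phi> (sigma n i) (x i) = \<ominus>\<^bsub>M\<^esub> (t_S \<odot>\<^bsub>M\<^esub> x i) \<and>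
         (i \<le> n - 2 \<longrightarrow> \<Phi> (sigma n i) (x (i + 1)) = x i \<oplus>\<^bsub>M\<^esub> x (i + 1)) \<and>
         (\<forall>j\<in>{1..n - 1} - {i - 1, i, i + 1}. \<Phi> (sigma n i) (x j) = x j) \<and>
         \<Phi> (sigma n i) y = (if i = n - 1 then y \<ominus>\<^bsub>M\<^esub> delta \<odot>\<^bsub>M\<^esub> x (n - 1) else y)) \<and>
      (\<forall>i\<in>{1..n - 1}.
         (i \<ge> 2 \<longrightarrow> \<Phi> (rho n i) (x (i - 1)) =
            (x (i - 1) \<oplus>\<^bsub>M\<^esub> delta \<odot>\<^bsub>M\<^esub> (\<Oplus>\<^bsub>M\<^esub>j\<in>{i..n - 1}. x j)) \<ominus>\<^bsub>M\<^esub> y) \<and>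
         \<Phi> (rho n i) (x i) =
            (\<ominus>\<^bsub>M\<^esub> (t_S \<odot>\<^bsub>M\<^esub> x i) \<ominus>\<^bsub>M\<^esub> delta \<odot>\<^bsub>M\<^esub> (\<Oplus>\<^bsub>M\<^esub>j\<in>{i + 1..n - 1}. x j)) \<oplus>\<^bsub>M\<^esub> y \<and>
         (\<forall>j\<in>{1..n - 1} - {i - 1, i}. \<Phi> (rho n i) (x j) = x j) \<and>
         \<Phi> (rho n i) y = y) \<and>
      (n \<ge> 2 \<longrightarrow> \<Phi> (rho n n) (x (n - 1)) = x (n - 1) \<ominus>\<^bsub>M\<^esub> y) \<and>
      (\<forall>j\<in>{1..n - 1} - {n - 1}. \<Phi> (rho n n) (x j) = x j) \<and>
      \<Phi> (rho n n) y = \<ominus>\<^bsub>M\<^esub> y)"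
proof (intro exI conjI)
  show "reduced_burau n (laurent.burau n)" by (rule reduced_burau_fox)
  show Phi: "ext_action n \<in> hom (LB_ext n) (mod_Aut class_ring (ext_module n))"
    by (rule ext_action_hom[OF assms])
  have "mult (LB n) = mult (LB_ext n)" by (simp add: LB_def LB_ext_def)
  with Phi show "ext_action n \<in> hom (LB n) (mod_Aut class_ring (ext_module n))"
    using LB_subset_LB_ext[of n] by (auto simp: hom_def)
  show "\<forall>g\<in>carrier (LB n). \<forall>v\<in>carrier_vec (n - 1).
      ext_action n g (v, 0) = (map_mat mod2 (laurent.burau n g) *\<^sub>v v, 0)"
    using ext_action_restrict[OF assms] by blast
  show "\<forall>g\<in>carrier (LB n). ext_action n g = ext_action n g" by simp
qed (unfold Let_def, intro conjI ballI impI;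
     (rule ext_action_tau ext_action_sigma ext_action_rho ext_action_rho_last[OF assms]; assumption))

end
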